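(* Let $\lambda\in(0,1)$, $d\in(0,1-\lambda)$, $\delta\in(1-\lambda-d,1)$, $a\in[0,1]$, and consider the map $f_{\delta,a}$. Let $\rho\in(0,1)$ and let $R_\rho:[0,1)\to[0,1)$ be the rotation of angle $\rho$, $R_\rho(y)=\{y+\rho\}$. Let $\alpha\in[0,1]$. Then the following assertions are equivalent: 1. The parameters $\delta$ and $a$ satisfy $\delta\in[\delta(\rho^-,\alpha),\delta(\rho,\alpha)]$ and $a\in[a(\delta,\rho^+,\alpha),a(\delta,\rho,\alpha)]$, with $\delta\neq\delta(\rho,\alpha)$ and $a\neq a(\delta,\rho^+,\alpha)$ whenever $\rho\in\mathbb{Q}$. 2. $\phi_{\delta,\rho,\alpha}([0,1))\subset[0,1)$ and $f_{\delta,a}\circ\phi_{\delta,\rho,\alpha}=\phi_{\delta,\rho,\alpha}\circ R_\rho$ on $[0,1)$. 3. For every $y\in[0,1)$ we have $$\theta_a(f^n_{\delta,a}(\phi_{\delta,\rho,\alpha}(y)))=\theta_\alpha(R^n_\rho(y))\quad\text{and}\quad\theta_\eta(f^n_{\delta,a}(\phi_{\delta,\rho,\alpha}(y)))=\theta_{1-\rho}(R^n_\rho(y))\quad\forall n\in\mathbb{N},$$ with $\alpha\in[0,1-\rho]$ and $\eta=\eta_1$ if $(\delta,a)\in M_1$, with $\alpha=1-\rho$ and $\eta=a$ if $(\delta,a)\in M_2$, and with $\alpha\in[1-\rho,1]$ and $\eta=\eta_2$ if $(\delta,a)\in M_3$. Also, if one of the equivalent assertions 1, 2, 3 holds, then $$\phi_{\delta,\rho,\alpha}([0,1))\subset\Lambda:=\bigcap_{n\in\mathbb{N}}f^n_{\delta,a}([0,1)).$$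 Moreover, (if one of the equivalent assertions 1, 2, 3 holds) if $\rho=p/q$, with $0<p<q$ co-prime, then $\phi_{\delta,\rho,\alpha}([0,1))$ is a $q$-periodic orbit of $f_{\delta,a}$ if $\alpha\in\{0,\tfrac1q,\tfrac2q,\dots,\tfrac{q-1}q,1\}$, and otherwise $\phi_{\delta,\rho,\alpha}([0,1))=\Lambda$ and is the union of the two $q$-periodic orbits of $f_{\delta,a}$. If $\rho\in(0,1)\setminus\mathbb{Q}$, then $\phi_{\delta,\rho,\alpha}([0,1))=\Lambda$ and $\overline{\Lambda}$ is a Cantor set.
   Context: Notation: $\mathbb{N}=\{0,1,2,\dots\}$; $\lfloor x\rfloor$ is the integer part and $\{x\}=x-\lfloor x\rfloor$ the fractional part of $x\in\mathbb{R}$. For $c\in\mathbb{R}$, $\theta_c(z)=0$ if $z<c$ and $\theta_c(z)=1$ if $z\ge c$. For $\delta,a\in[0,1]$, let $F:\mathbb{R}\to\mathbb{R}$, $F(x)=\lambda x+\delta+(1-\lambda)\lfloor x\rfloor+d\,\theta_a(\{x\})$, and let $f_{\delta,a}:[0,1)\to[0,1)$, $f_{\delta,a}(x)=F(x)\pmod1$. For $\rho,\alpha\in[0,1]$ define $$\delta(\rho,\alpha)=1-\lambda-d+\frac{1-\lambda}{\lambda}\sum_{k=1}^{\infty}\lambda^k\left((1-\lambda)\lfloor k\rho\rfloor+d\,\theta_{1-\alpha}(\{k\rho\})\right),$$ $$a(\delta,\rho,\alpha)=\frac{\delta}{1-\lambda}+\frac1\lambda\sum_{k=1}^{\infty}\lambda^k\left((1-\lambda)\lfloor\alpha-k\rho\rfloor+d\,\theta_\alpha(\{\alpha-k\rho\})\right)\quad\forall\delta\in[0,1].$$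 For $\rho\in(0,1)$, $\delta(\rho^-,\alpha)=\lim_{r\to\rho^-}\delta(r,\alpha)$ and $a(\delta,\rho^+,\alpha)=\lim_{r\to\rho^+}a(\delta,r,\alpha)$. For $\alpha\in[0,1]$ let $\psi_\alpha(z)=(1-\lambda)\lfloor z\rfloor+d\,\theta_\alpha(\{z\})$, $z\in\mathbb{R}$, and for $\delta,\rho,\alpha\in[0,1]$ let $\phi_{\delta,\rho,\alpha}:\mathbb{R}\to\mathbb{R}$, $$\phi_{\delta,\rho,\alpha}(y)=\frac{\delta}{1-\lambda}+\frac1\lambda\sum_{k=1}^\infty\lambda^k\psi_\alpha(y-k\rho).$$ For given $\delta$ set $\eta_1=\frac{1-\delta-d}{\lambda}$, $\eta_2=\frac{1-\delta}{\lambda}$. The following sets partition $(1-\lambda-d,1)\times[0,1]$: $M_1=\{(\delta,a):\delta\in(1-\lambda-d,1-d),\ a\in[0,\eta_1)\}$, $M_2=\{(\delta,a):\delta\in(1-\lambda-d,1),\ a\in[0,1]\cap[\eta_1,\eta_2]\}$, $M_3=\{(\delta,a):\delta\in(1-\lambda,1),\ a\in(\eta_2,1]\}$. *)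

theory Defs
  imports "HOL-Analysis.Analysis"
begin

text \<open>
  Throughout, \<open>lam\<close> is the slope and \<open>d\<close> the jump parameter; the intended range is
  \<open>0 < lam < 1\<close> and \<open>0 < d < 1 - lam\<close>.
\<close>

definition theta :: "real \<Rightarrow> real \<Rightarrow> real" where
  "theta c z = (if z < c then 0 else 1)"

definition lift_F :: "real \<Rightarrow> real \<Rightarrow> real \<Rightarrow> real \<Rightarrow> real \<Rightarrow> real" where
  "lift_F lam d \<delta> a x = lam * x + \<delta> + (1 - lam) * of_int \<lfloor>x\<rfloor> + d * theta a (frac x)"

text \<open>
  The circle map and the rotation are self-maps of \<open>[0,1)\<close> in the mathematics. They are total
  functions here, with values in \<open>[0,1)\<close>, and \<open>[0,1)\<close> is kept explicit where they are used.
\<close>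

definition f_map :: "real \<Rightarrow> real \<Rightarrow> real \<Rightarrow> real \<Rightarrow> real \<Rightarrow> real" where
  "f_map lam d \<delta> a x = frac (lift_F lam d \<delta> a x)"

definition rotation :: "real \<Rightarrow> real \<Rightarrow> real" where
  "rotation \<rho> y = frac (y + \<rho>)"

text \<open>The sums over \<open>k \<ge> 1\<close> are written as series over all natural numbers, with \<open>Suc k\<close> for \<open>k\<close>.\<close>

definition delta_par :: "real \<Rightarrow> real \<Rightarrow> real \<Rightarrow> real \<Rightarrow> real" where
  "delta_par lam d \<rho> \<alpha> =
     1 - lam - d + (1 - lam) / lam *
       (\<Sum>k. lam ^ Suc k *
          ((1 - lam) * of_int \<lfloor>real (Suc k) * \<rho>\<rfloor> + d * theta (1 - \<alpha>) (frac (real (Suc k) * \<rho>))))"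

definition a_par :: "real \<Rightarrow> real \<Rightarrow> real \<Rightarrow> real \<Rightarrow> real \<Rightarrow> real" where
  "a_par lam d \<delta> \<rho> \<alpha> =
     \<delta> / (1 - lam) + 1 / lam *
       (\<Sum>k. lam ^ Suc k *
          ((1 - lam) * of_int \<lfloor>\<alpha> - real (Suc k) * \<rho>\<rfloor> + d * theta \<alpha> (frac (\<alpha> - real (Suc k) * \<rho>))))"

definition delta_par_left :: "real \<Rightarrow> real \<Rightarrow> real \<Rightarrow> real \<Rightarrow> real" where
  "delta_par_left lam d \<rho> \<alpha> = Lim (at_left \<rho>) (\<lambda>r. delta_par lam d r \<alpha>)"

definition a_par_right :: "real \<Rightarrow> real \<Rightarrow> real \<Rightarrow> real \<Rightarrow> real \<Rightarrow> real" where
  "a_par_right lam d \<delta> \<rho> \<alpha> = Lim (at_right \<rho>) (\<lambda>r. a_par lam d \<delta> r \<alpha>)"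

definition psi :: "real \<Rightarrow> real \<Rightarrow> real \<Rightarrow> real \<Rightarrow> real" where
  "psi lam d \<alpha> z = (1 - lam) * of_int \<lfloor>z\<rfloor> + d * theta \<alpha> (frac z)"

definition phi :: "real \<Rightarrow> real \<Rightarrow> real \<Rightarrow> real \<Rightarrow> real \<Rightarrow> real \<Rightarrow> real" where
  "phi lam d \<delta> \<rho> \<alpha> y =
     \<delta> / (1 - lam) + 1 / lam * (\<Sum>k. lam ^ Suc k * psi lam d \<alpha> (y - real (Suc k) * \<rho>))"

definition eta1 :: "real \<Rightarrow> real \<Rightarrow> real \<Rightarrow> real" where
  "eta1 lam d \<delta> = (1 - \<delta> - d) / lam"

definition eta2 :: "real \<Rightarrow> real \<Rightarrow> real" where
  "eta2 lam \<delta> = (1 - \<delta>) / lam"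

definition M1 :: "real \<Rightarrow> real \<Rightarrow> (real \<times> real) set" where
  "M1 lam d = {(\<delta>, a). \<delta> \<in> {1 - lam - d<..<1 - d} \<and> a \<in> {0..<eta1 lam d \<delta>}}"

definition M2 :: "real \<Rightarrow> real \<Rightarrow> (real \<times> real) set" where
  "M2 lam d = {(\<delta>, a). \<delta> \<in> {1 - lam - d<..<1} \<and> a \<in> {0..1} \<inter> {eta1 lam d \<delta>..eta2 lam \<delta>}}"

definition M3 :: "real \<Rightarrow> (real \<times> real) set" where
  "M3 lam = {(\<delta>, a). \<delta> \<in> {1 - lam<..<1} \<and> a \<in> {eta2 lam \<delta><..1}}"

definition parameter_condition :: "real \<Rightarrow> real \<Rightarrow> real \<Rightarrow> real \<Rightarrow> real \<Rightarrow> real \<Rightarrow> bool" where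
  "parameter_condition lam d \<delta> a \<rho> \<alpha> \<longleftrightarrow>
     \<delta> \<in> {delta_par_left lam d \<rho> \<alpha>..delta_par lam d \<rho> \<alpha>} \<and>
     a \<in> {a_par_right lam d \<delta> \<rho> \<alpha>..a_par lam d \<delta> \<rho> \<alpha>} \<and>
     (\<rho> \<in> \<rat> \<longrightarrow> \<delta> \<noteq> delta_par lam d \<rho> \<alpha> \<and> a \<noteq> a_par_right lam d \<delta> \<rho> \<alpha>)"

definition semiconjugacy_condition :: "real \<Rightarrow> real \<Rightarrow> real \<Rightarrow> real \<Rightarrow> real \<Rightarrow> real \<Rightarrow> bool" where
  "semiconjugacy_condition lam d \<delta> a \<rho> \<alpha> \<longleftrightarrow>
     phi lam d \<delta> \<rho> \<alpha> ` {0..<1} \<subseteq> {0..<1} \<and>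
     (\<forall>y\<in>{0..<1}. (f_map lam d \<delta> a \<circ> phi lam d \<delta> \<rho> \<alpha>) y = (phi lam d \<delta> \<rho> \<alpha> \<circ> rotation \<rho>) y)"

text \<open>
  Exactly one of the three alternatives for \<open>(\<delta>, a)\<close> applies, as the sets \<open>M1\<close>, \<open>M2\<close>, \<open>M3\<close>
  partition the parameter domain; the requirement on \<open>\<alpha>\<close> in that alternative is part of the
  condition. It is not required separately that \<open>phi\<close> maps \<open>[0,1)\<close> into itself.
\<close>

definition coding_condition :: "real \<Rightarrow> real \<Rightarrow> real \<Rightarrow> real \<Rightarrow> real \<Rightarrow> real \<Rightarrow> bool" where
  "coding_condition lam d \<delta> a \<rho> \<alpha> \<longleftrightarrow>
     (\<exists>\<eta>. ((\<delta>, a) \<in> M1 lam d \<and> \<alpha> \<in> {0..1 - \<rho>} \<and> \<eta> = eta1 lam d \<delta> \<or>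
           (\<delta>, a) \<in> M2 lam d \<and> \<alpha> = 1 - \<rho> \<and> \<eta> = a \<or>
           (\<delta>, a) \<in> M3 lam \<and> \<alpha> \<in> {1 - \<rho>..1} \<and> \<eta> = eta2 lam \<delta>) \<and>
          (\<forall>y\<in>{0..<1}. \<forall>n.
             theta a ((f_map lam d \<delta> a ^^ n) (phi lam d \<delta> \<rho> \<alpha> y)) = theta \<alpha> ((rotation \<rho> ^^ n) y) \<and>
             theta \<eta> ((f_map lam d \<delta> a ^^ n) (phi lam d \<delta> \<rho> \<alpha> y)) = theta (1 - \<rho>) ((rotation \<rho> ^^ n) y)))"

definition attractor :: "real \<Rightarrow> real \<Rightarrow> real \<Rightarrow> real \<Rightarrow> real set" where
  "attractor lam d \<delta> a = (\<Inter>n. (f_map lam d \<delta> a ^^ n) ` {0..<1})"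

text \<open>An orbit of minimal period \<open>q\<close> of a self-map of \<open>[0,1)\<close>.\<close>

definition periodic_orbit :: "(real \<Rightarrow> real) \<Rightarrow> nat \<Rightarrow> real set \<Rightarrow> bool" where
  "periodic_orbit g q P \<longleftrightarrow> q > 0 \<and>
     (\<exists>x\<in>{0..<1}. (g ^^ q) x = x \<and> (\<forall>k. 0 < k \<and> k < q \<longrightarrow> (g ^^ k) x \<noteq> x) \<and>
        P = (\<lambda>k. (g ^^ k) x) ` {..<q})"

text \<open>Nonempty, compact, without isolated points, and totally disconnected.\<close>

definition cantor_set :: "real set \<Rightarrow> bool" where
  "cantor_set S \<longleftrightarrow> S \<noteq> {} \<and> compact S \<and> (\<forall>x\<in>S. \<not> x isolated_in S) \<and>
     (\<forall>x\<in>S. connected_component_set S x = {x})"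

end

theory Submission
  imports Defs
begin

text \<open>
  Writing \<open>F z = lam * z + \<delta> + psi lam d a z\<close>, the function \<open>\<phi>\<close> satisfies
  \<open>\<phi> (y + \<rho>) = lam * \<phi> y + \<delta> + psi lam d \<alpha> y\<close>, so \<open>\<phi>\<close> conjugates the rotation to \<open>F\<close> as soon as
  it matches the discontinuities \<open>0\<close> and \<open>a\<close> of \<open>F\<close> with the jumps \<open>0\<close> and \<open>\<alpha>\<close> of
  \<open>psi lam d \<alpha>\<close>: \<open>0 \<le> \<phi> y \<longleftrightarrow> 0 \<le> y\<close> and \<open>a \<le> \<phi> y \<longleftrightarrow> \<alpha> \<le> y\<close>. Each of the three conditions is
  equivalent to this matching; for the parameter condition because its four bounds are affine
  functions of the values and left limits of \<open>\<phi>\<close> at \<open>0\<close> and \<open>\<alpha>\<close>.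

  A point of the attractor has a full backward orbit, and the cut \<open>v\<close> of \<open>\<phi>\<close> at that point is
  moved by \<open>- \<rho>\<close> in each backward step. Where the codes of the backward orbit and of
  \<open>v - k * \<rho>\<close> agree, contraction identifies the point with \<open>\<phi> v\<close>. The codes can only differ when
  \<open>v - k * \<rho>\<close> hits a jump, which happens finitely often for irrational \<open>\<rho>\<close>, and on a fixed
  side of the jump for rational \<open>\<rho>\<close> and generic \<open>\<alpha>\<close>.
\<close>

subsection \<open>The series defining \<open>\<phi>\<close>\<close>

locale slopes =
  fixes lam d :: real
  assumes lam: "0 < lam" "lam < 1" and d: "0 < d" "d < 1 - lam"
begin

lemma theta_bounds: "0 \<le> theta c z" "theta c z \<le> 1"
  by (simp_all add: theta_def)

text \<open>\<open>psi\<close> sees its argument only through the integers and the translates of the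
  threshold below it. Allowing two thresholds makes it possible to compare an orbit of
  \<open>lift_F\<close> (threshold \<open>a\<close>) with an orbit of the rotation (threshold
  \<open>\<alpha>\<close>).\<close>

lemma psi_eqI:
  assumes "\<And>m::int. of_int m \<le> z \<longleftrightarrow> of_int m \<le> y"
    and "\<And>m::int. a + of_int m \<le> z \<longleftrightarrow> \<alpha> + of_int m \<le> y"
  shows "psi lam d a z = psi lam d \<alpha> y"
proof -
  have "\<lfloor>z\<rfloor> = \<lfloor>y\<rfloor>"
    using assms(1) by (metis antisym le_floor_iff order_refl)
  moreover have "frac z < a \<longleftrightarrow> frac y < \<alpha>"
    using assms(2)[of "\<lfloor>y\<rfloor>"] calculation unfolding frac_def by linarith
  ultimately show ?thesis
    by (simp add: psi_def theta_def)
qed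

lemma psi_less_floor:
  assumes "z < of_int m"
  shows "psi lam d \<alpha> z \<le> (1 - lam) * (of_int m - 1) + d"
proof -
  have "\<lfloor>z\<rfloor> \<le> m - 1"
    using assms by linarith
  then have "of_int \<lfloor>z\<rfloor> \<le> (of_int m - 1 :: real)"
    by linarith
  then have "(1 - lam) * of_int \<lfloor>z\<rfloor> \<le> (1 - lam) * (of_int m - 1)"
    using lam by (intro mult_left_mono) auto
  moreover have "d * theta \<alpha> (frac z) \<le> d * 1"
    using d theta_bounds by (intro mult_left_mono) auto
  ultimately show ?thesis
    by (simp add: psi_def)
qed

lemma psi_ge_floor: "(1 - lam) * of_int \<lfloor>z\<rfloor> \<le> psi lam d \<alpha> z"
  using d theta_bounds[of \<alpha> "frac z"] by (simp add: psi_def)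

text \<open>At an integer the floor part gains \<open>1 - lam\<close> while the threshold part loses
  at most \<open>d\<close>; the net gain is positive because \<open>d < 1 - lam\<close>.\<close>

lemma psi_gap_int:
  assumes "z < of_int m"
  shows "psi lam d \<alpha> z + (1 - lam - d) \<le> psi lam d \<alpha> (of_int m)"
  using psi_less_floor[OF assms, of \<alpha>] psi_ge_floor[of "of_int m" \<alpha>]
  by (simp add: algebra_simps)

lemma psi_mono:
  assumes "z \<le> y"
  shows "psi lam d \<alpha> z \<le> psi lam d \<alpha> y"
proof (cases "\<lfloor>z\<rfloor> = \<lfloor>y\<rfloor>")
  case True
  then have "frac z \<le> frac y"
    using assms by (simp add: frac_def)
  then show ?thesis
    using True d by (auto simp: psi_def theta_def)
next
  case False
  then have "\<lfloor>z\<rfloor> < \<lfloor>y\<rfloor>"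
    using assms floor_mono[of z y] by linarith
  then have "z < of_int \<lfloor>y\<rfloor>"
    by linarith
  from psi_less_floor[OF this, of \<alpha>] psi_ge_floor[of y \<alpha>] show ?thesis
    using d by (simp add: algebra_simps)
qed

text \<open>For \<open>\<alpha> = 1\<close> there is no such jump, since a fractional part never
  reaches 1.\<close>

lemma psi_gap_threshold:
  assumes "0 \<le> \<alpha>" "\<alpha> < 1" "z < \<alpha> + of_int m"
  shows "psi lam d \<alpha> z + d \<le> psi lam d \<alpha> (\<alpha> + of_int m)"
proof -
  have fl: "\<lfloor>\<alpha> + of_int m\<rfloor> = m"
    using assms by linarith
  have top: "psi lam d \<alpha> (\<alpha> + of_int m) = (1 - lam) * of_int m + d"
    using fl by (simp add: psi_def theta_def frac_def)
  show ?thesis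
  proof (cases "z < of_int m")
    case True
    from psi_less_floor[OF this, of \<alpha>] show ?thesis
      unfolding top using d by (simp add: algebra_simps)
  next
    case False
    then have "\<lfloor>z\<rfloor> = m"
      using assms by linarith
    then show ?thesis
      using assms(3) unfolding top by (simp add: psi_def theta_def frac_def)
  qed
qed

lemma psi_shift: "psi lam d \<alpha> (z + of_int m) = psi lam d \<alpha> z + (1 - lam) * of_int m"
  by (simp add: psi_def frac_def algebra_simps)

lemma psi_bound: "\<bar>psi lam d \<alpha> z\<bar> \<le> \<bar>z\<bar> + 2"
proof -
  have "\<bar>(1 - lam) * of_int \<lfloor>z\<rfloor>\<bar> \<le> 1 * \<bar>of_int \<lfloor>z\<rfloor>\<bar>"
    using lam unfolding abs_mult by (intro mult_right_mono) auto
  moreover have "\<bar>real_of_int \<lfloor>z\<rfloor>\<bar> \<le> \<bar>z\<bar> + 1"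
    by linarith
  moreover have "\<bar>d * theta \<alpha> (frac z)\<bar> \<le> 1"
    using lam d by (simp add: theta_def)
  ultimately show ?thesis
    unfolding psi_def by linarith
qed

text \<open>Left limits exchange \<open>\<alpha>\<close> with \<open>1 - \<alpha>\<close>: this is the origin of the threshold \<open>1 - \<alpha>\<close> in
  \<open>delta_par\<close>.\<close>

lemma psi_at_left:
  assumes "0 \<le> \<alpha>" "\<alpha> \<le> 1"
  shows "\<forall>\<^sub>F t in at_left z. psi lam d \<alpha> t = - psi lam d (1 - \<alpha>) (- z) - (1 - lam - d)"
proof -
  define n where "n = \<lceil>z\<rceil> - 1"
  have n: "of_int n < z" "z \<le> of_int n + 1"
    unfolding n_def by linarith+
  \<comment> \<open>\<open>b\<close> is the last jump point of \<open>psi\<close> strictly left of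
    \<open>z\<close>, so \<open>psi\<close> is constant on \<open>(b, z)\<close>.\<close>
  define b where "b = (if z \<le> of_int n + \<alpha> then of_int n else of_int n + \<alpha>)"
  have "b < z"
    using n by (auto simp: b_def)
  then have "\<forall>\<^sub>F t in at_left z. t \<in> {b<..<z}"
    by (rule eventually_at_left_real)
  then show ?thesis
  proof eventually_elim
    case (elim t)
    have ft: "\<lfloor>t\<rfloor> = n"
      using elim n assms by (intro floor_unique) (auto simp: b_def split: if_splits)
    have fz: "\<lfloor>- z\<rfloor> = - (n + 1)"
      using n by (intro floor_unique) auto
    show ?case
      using elim unfolding psi_def theta_def frac_def ft fz
      by (auto simp: b_def algebra_simps split: if_splits)
  qed
qed

text \<open>The floor and the convention \<open>theta c c = 1\<close> are both right-continuous, so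
  \<open>psi\<close> is constant from \<open>z\<close> up to its next jump point \<open>b\<close>.
  The \<open>min\<close> covers thresholds above 1.\<close>

lemma psi_at_right: "\<forall>\<^sub>F t in at_right z. psi lam d \<alpha> t = psi lam d \<alpha> z"
proof -
  define b where "b = of_int \<lfloor>z\<rfloor> + (if frac z < \<alpha> then min \<alpha> 1 else 1)"
  have "z < b"
    by (auto simp: b_def frac_def min_def)
  then have "\<forall>\<^sub>F t in at_right z. t \<in> {z<..<b}"
    by (rule eventually_at_right_real)
  then show ?thesis
  proof eventually_elim
    case (elim t)
    have ft: "\<lfloor>t\<rfloor> = \<lfloor>z\<rfloor>"
      using elim by (intro floor_unique) (auto simp: b_def le_floor_iff[symmetric] min_def split: if_splits, linarith+)
    show ?case
      using elim unfolding psi_def theta_def frac_def ft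
      by (auto simp: b_def frac_def min_def split: if_splits)
  qed
qed

text \<open>Passes from the normalisation of \<open>phi\<close> to that of
  \<open>delta_par\<close>.\<close>

lemma scale_series: "(1 - lam) * (x / (1 - lam) + 1 / lam * S) = x + (1 - lam) / lam * S"
  using lam by (simp add: distrib_left)

lemma scale_weights: "(1 - lam) / lam * (- S - lam / (1 - lam) * c) = - ((1 - lam) / lam * S) - c"
  using lam by (simp add: right_diff_distrib)

text \<open>The arguments of \<open>psi\<close> grow at most linearly in \<open>k\<close>, so this
  series dominates all the series below.\<close>

lemma weights_summable: "summable (\<lambda>k. lam ^ Suc k * (C + real (Suc k)))"
proof -
  have "summable (\<lambda>k. real (Suc k) * lam ^ k)"
    using geometric_deriv_sums[of lam] lam sums_summable by force
  then have "summable (\<lambda>k. lam * (C * lam ^ k + real (Suc k) * lam ^ k))"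
    using lam by (intro summable_mult summable_add) (auto simp: summable_geometric)
  then show ?thesis
    by (simp add: algebra_simps)
qed

lemma psi_term_bound:
  assumes "\<bar>u\<bar> \<le> C + real (Suc k)"
  shows "norm (lam ^ Suc k * psi lam d \<beta> u) \<le> lam ^ Suc k * (C + 2 + real (Suc k))"
proof -
  have "\<bar>psi lam d \<beta> u\<bar> \<le> C + 2 + real (Suc k)"
    using psi_bound[of \<beta> u] assms by linarith
  then show ?thesis
    unfolding real_norm_def abs_mult using lam by (intro mult_mono) auto
qed

lemma psi_series_summable:
  assumes "\<And>k. \<bar>u k\<bar> \<le> C + real (Suc k)"
  shows "summable (\<lambda>k. lam ^ Suc k * psi lam d \<beta> (u k))"
  by (rule summable_comparison_test[OF _ weights_summable[of "C + 2"]])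
    (use psi_term_bound[OF assms] in blast)

text \<open>Tannery's theorem. Termwise convergence is required as eventual equality, which is what
  the one-sided local constancy of \<open>psi\<close> provides; \<open>t\<close> will be the
  argument of \<open>\<phi>\<close> or the rotation number.\<close>

lemma psi_series_tendsto:
  assumes "F \<noteq> bot"
    and lim: "\<And>k. \<forall>\<^sub>F t in F. psi lam d \<beta> (u t k) = l k"
    and bd: "\<forall>\<^sub>F t in F. \<forall>k. \<bar>u t k\<bar> \<le> C + real (Suc k)"
  shows "((\<lambda>t. \<Sum>k. lam ^ Suc k * psi lam d \<beta> (u t k)) \<longlongrightarrow> (\<Sum>k. lam ^ Suc k * l k)) F"
proof -
  have "\<forall>\<^sub>F (k, t) in sequentially \<times>\<^sub>F F.
      norm (lam ^ Suc k * psi lam d \<beta> (u t k)) \<le> lam ^ Suc k * (C + 2 + real (Suc k))"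
    unfolding eventually_prod_filter
    by (rule exI[of _ "\<lambda>_. True"],
        rule exI[of _ "\<lambda>t. \<forall>k. \<bar>u t k\<bar> \<le> C + real (Suc k)"])
      (use bd psi_term_bound in auto)
  moreover have "((\<lambda>t. lam ^ Suc k * psi lam d \<beta> (u t k)) \<longlongrightarrow> lam ^ Suc k * l k) F" for k
    by (intro tendsto_mult tendsto_const tendsto_eventually lim)
  ultimately show ?thesis
    by (intro conjunct2[OF conjunct2[OF tannerys_theorem[OF _ _ weights_summable assms(1)]]])
qed

end

text \<open>The left limit of \<open>phi\<close>, with the left limits of the summands supplied by \<open>psi_at_left\<close>.\<close>

definition phi_left :: "real \<Rightarrow> real \<Rightarrow> real \<Rightarrow> real \<Rightarrow> real \<Rightarrow> real \<Rightarrow> real" where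
  "phi_left lam d \<delta> \<rho> \<alpha> y =
     \<delta> / (1 - lam) + 1 / lam *
       (\<Sum>k. lam ^ Suc k * (- psi lam d (1 - \<alpha>) (real (Suc k) * \<rho> - y) - (1 - lam - d)))"

section \<open>The function \<open>\<phi>\<close>: monotonicity, jumps, functional equation and
  one-sided limits\<close>

locale coding = slopes +
  fixes \<delta> \<rho> \<alpha> :: real
  assumes rho: "0 < \<rho>" "\<rho> < 1" and alpha: "0 \<le> \<alpha>" "\<alpha> \<le> 1"
begin

abbreviation \<phi> :: "real \<Rightarrow> real" where "\<phi> \<equiv> phi lam d \<delta> \<rho> \<alpha>"
abbreviation \<phi>\<^sub>l :: "real \<Rightarrow> real" where "\<phi>\<^sub>l \<equiv> phi_left lam d \<delta> \<rho> \<alpha>"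
abbreviation \<psi> :: "real \<Rightarrow> real" where "\<psi> \<equiv> psi lam d \<alpha>"

lemma arg_bound: "\<bar>y - real (Suc k) * r\<bar> \<le> \<bar>y\<bar> + real (Suc k)" if "0 \<le> r" "r \<le> 1"
proof -
  have "\<bar>real (Suc k) * r\<bar> \<le> real (Suc k) * 1"
    unfolding abs_mult using that by (intro mult_mono) auto
  with abs_triangle_ineq4[of y "real (Suc k) * r"] show ?thesis
    by (metis add_left_mono mult.right_neutral order_trans)
qed

lemma phi_summable: "summable (\<lambda>k. lam ^ Suc k * psi lam d \<beta> (y - real (Suc k) * \<rho>))"
  using arg_bound[of \<rho> y] rho by (intro psi_series_summable[of _ "\<bar>y\<bar>"]) auto

lemma phi_mono: "x \<le> y \<Longrightarrow> \<phi> x \<le> \<phi> y"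
  unfolding phi_def using lam
  by (intro add_left_mono mult_left_mono suminf_le phi_summable psi_mono) auto

text \<open>All summands are monotone, so the gain of a single one bounds the total gain from below;
  the factor \<open>1 / lam\<close> turns its weight \<open>lam ^ Suc k\<close> into
  \<open>lam ^ k\<close>.\<close>

lemma phi_gap:
  assumes "x \<le> y" and gap: "\<psi> (x - real (Suc k) * \<rho>) + g \<le> \<psi> (y - real (Suc k) * \<rho>)"
  shows "\<phi> x + lam ^ k * g \<le> \<phi> y"
proof -
  let ?t = "\<lambda>y k. lam ^ Suc k * \<psi> (y - real (Suc k) * \<rho>)"
  have "(\<Sum>j\<in>{k}. ?t y j - ?t x j) \<le> (\<Sum>j. ?t y j - ?t x j)"
    using assms(1) lam by (intro sum_le_suminf summable_diff phi_summable) (auto intro: psi_mono)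
  also have "\<dots> = (\<Sum>j. ?t y j) - (\<Sum>j. ?t x j)"
    by (rule suminf_diff[symmetric]) (rule phi_summable)+
  finally have "?t y k - ?t x k \<le> (\<Sum>j. ?t y j) - (\<Sum>j. ?t x j)"
    by simp
  moreover have "lam ^ Suc k * g \<le> lam ^ Suc k * (\<psi> (y - real (Suc k) * \<rho>) - \<psi> (x - real (Suc k) * \<rho>))"
    using gap lam by (intro mult_left_mono) auto
  ultimately have "lam ^ Suc k * g \<le> (\<Sum>j. ?t y j) - (\<Sum>j. ?t x j)"
    by (simp only: right_diff_distrib)
  then have "1 / lam * (lam ^ Suc k * g) \<le> 1 / lam * ((\<Sum>j. ?t y j) - (\<Sum>j. ?t x j))"
    using lam by (intro mult_left_mono) auto
  then show ?thesis
    using lam by (simp add: phi_def right_diff_distrib)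
qed

text \<open>\<open>\<phi>\<close> jumps where the argument of one of its summands meets an integer,
  that is, at the forward rotates of 0; the jump size does not depend on \<open>x\<close>.\<close>

lemma phi_gap_int:
  assumes "x < y" "y = of_int m + real (Suc k) * \<rho>"
  shows "\<phi> x + lam ^ k * (1 - lam - d) \<le> \<phi> y"
  using assms psi_gap_int[of "x - real (Suc k) * \<rho>" m \<alpha>] by (intro phi_gap) auto

lemma phi_gap_threshold:
  assumes "\<alpha> < 1" "x < y" "y = \<alpha> + of_int m + real (Suc k) * \<rho>"
  shows "\<phi> x + lam ^ k * d \<le> \<phi> y"
  using assms alpha psi_gap_threshold[of \<alpha> "x - real (Suc k) * \<rho>" m] by (intro phi_gap) auto

lemma phi_eqI:
  assumes "\<And>k m. of_int m + real (Suc k) * \<rho> \<le> x \<longleftrightarrow> of_int m + real (Suc k) * \<rho> \<le> y"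
    and "\<And>k m. \<alpha> + of_int m + real (Suc k) * \<rho> \<le> x \<longleftrightarrow> \<alpha> + of_int m + real (Suc k) * \<rho> \<le> y"
  shows "\<phi> x = \<phi> y"
proof -
  have "\<psi> (x - real (Suc k) * \<rho>) = \<psi> (y - real (Suc k) * \<rho>)" for k
    using assms by (intro psi_eqI) (simp_all add: le_diff_eq)
  then show ?thesis by (simp add: phi_def)
qed

lemma weights_sums: "(\<lambda>k. lam ^ Suc k) sums (lam / (1 - lam))"
  using sums_mult[OF geometric_sums[of lam], of lam] lam by simp

text \<open>\<open>\<phi>\<close> has degree one: each summand shifts by
  \<open>(1 - lam) * m\<close>, and the weights add up to \<open>lam / (1 - lam)\<close>.\<close>

lemma phi_shift: "\<phi> (y + of_int m) = \<phi> y + of_int m"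
proof -
  have "(\<lambda>k. lam ^ Suc k * \<psi> (y - real (Suc k) * \<rho>) + lam ^ Suc k * ((1 - lam) * of_int m)) sums
      ((\<Sum>k. lam ^ Suc k * \<psi> (y - real (Suc k) * \<rho>)) + lam / (1 - lam) * ((1 - lam) * of_int m))"
    by (intro sums_add sums_mult2 weights_sums summable_sums phi_summable)
  moreover have "\<psi> (y + of_int m - real (Suc k) * \<rho>) = \<psi> (y - real (Suc k) * \<rho>) + (1 - lam) * of_int m" for k
    using psi_shift[of \<alpha> "y - real (Suc k) * \<rho>" m] by (simp add: add_diff_eq diff_add_eq)
  ultimately have "(\<lambda>k. lam ^ Suc k * \<psi> (y + of_int m - real (Suc k) * \<rho>)) sums
      ((\<Sum>k. lam ^ Suc k * \<psi> (y - real (Suc k) * \<rho>)) + lam / (1 - lam) * ((1 - lam) * of_int m))"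
    by (simp only: distrib_left)
  from sums_unique[OF this] have "(\<Sum>k. lam ^ Suc k * \<psi> (y + of_int m - real (Suc k) * \<rho>)) =
      (\<Sum>k. lam ^ Suc k * \<psi> (y - real (Suc k) * \<rho>)) + lam * of_int m"
    using lam by simp
  then show ?thesis
    unfolding phi_def using lam by (simp add: field_simps)
qed

text \<open>The first summand at \<open>y + \<rho>\<close> has argument \<open>y\<close>; the
  remaining ones form \<open>lam\<close> times the series at \<open>y\<close>.\<close>

lemma phi_rec: "\<phi> (y + \<rho>) = lam * \<phi> y + \<delta> + \<psi> y"
proof -
  have s: "summable (\<lambda>k. lam ^ Suc k * \<psi> (y + \<rho> - real (Suc k) * \<rho>))"
    by (rule phi_summable)
  have "(\<Sum>k. lam ^ Suc (Suc k) * \<psi> (y + \<rho> - real (Suc (Suc k)) * \<rho>)) =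
      (\<Sum>k. lam * (lam ^ Suc k * \<psi> (y - real (Suc k) * \<rho>)))"
    by (intro suminf_cong) (simp add: algebra_simps)
  also have "\<dots> = lam * (\<Sum>k. lam ^ Suc k * \<psi> (y - real (Suc k) * \<rho>))"
    by (rule suminf_mult) (rule phi_summable)
  finally have "(\<Sum>k. lam ^ Suc k * \<psi> (y + \<rho> - real (Suc k) * \<rho>)) =
      lam * (\<Sum>k. lam ^ Suc k * \<psi> (y - real (Suc k) * \<rho>)) + lam * \<psi> y"
    using suminf_split_head[OF s] by simp
  then show ?thesis
    unfolding phi_def using lam by (simp add: field_simps)
qed

lemma arg_bound_near:
  assumes "\<bar>t - y\<bar> \<le> 1"
  shows "\<bar>t - real (Suc k) * \<rho>\<bar> \<le> \<bar>y\<bar> + 1 + real (Suc k)"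
proof -
  have "\<bar>t\<bar> \<le> \<bar>y\<bar> + 1" using assms by linarith
  with arg_bound[of \<rho> t k] rho show ?thesis
    by linarith
qed

lemma phi_tendsto_left: "(\<phi> \<longlongrightarrow> \<phi>\<^sub>l y) (at_left y)"
  unfolding phi_def phi_left_def
proof (intro tendsto_intros psi_series_tendsto[where C = "\<bar>y\<bar> + 1"])
  fix k
  let ?c = "real (Suc k) * \<rho>"
  obtain b where b: "b < y - ?c"
    "\<And>t. b < t \<Longrightarrow> t < y - ?c \<Longrightarrow> \<psi> t = - psi lam d (1 - \<alpha>) (- (y - ?c)) - (1 - lam - d)"
    using psi_at_left[OF alpha, of "y - ?c"] unfolding eventually_at_left_field by blast
  have "\<forall>\<^sub>F t in at_left y. t \<in> {b + ?c<..<y}"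
    using b(1) by (intro eventually_at_left_real) simp
  then show "\<forall>\<^sub>F t in at_left y. \<psi> (t - ?c) = - psi lam d (1 - \<alpha>) (?c - y) - (1 - lam - d)"
    by eventually_elim (use b(2) in auto)
next
  have "\<forall>\<^sub>F t in at_left y. t \<in> {y - 1<..<y}"
    by (intro eventually_at_left_real) simp
  then show "\<forall>\<^sub>F t in at_left y. \<forall>k. \<bar>t - real (Suc k) * \<rho>\<bar> \<le> \<bar>y\<bar> + 1 + real (Suc k)"
    by eventually_elim (auto intro!: arg_bound_near simp del: of_nat_Suc)
qed simp

lemma phi_tendsto_right: "(\<phi> \<longlongrightarrow> \<phi> y) (at_right y)"
  unfolding phi_def
proof (intro tendsto_intros psi_series_tendsto[where C = "\<bar>y\<bar> + 1"])
  fix k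
  let ?c = "real (Suc k) * \<rho>"
  obtain b where b: "y - ?c < b" "\<And>t. y - ?c < t \<Longrightarrow> t < b \<Longrightarrow> \<psi> t = \<psi> (y - ?c)"
    using psi_at_right[of \<alpha> "y - ?c"] unfolding eventually_at_right_field by blast
  have "\<forall>\<^sub>F t in at_right y. t \<in> {y<..<b + ?c}"
    using b(1) by (intro eventually_at_right_real) simp
  then show "\<forall>\<^sub>F t in at_right y. \<psi> (t - ?c) = \<psi> (y - ?c)"
    by eventually_elim (use b(2) in auto)
next
  have "\<forall>\<^sub>F t in at_right y. t \<in> {y<..<y + 1}"
    by (intro eventually_at_right_real) simp
  then show "\<forall>\<^sub>F t in at_right y. \<forall>k. \<bar>t - real (Suc k) * \<rho>\<bar> \<le> \<bar>y\<bar> + 1 + real (Suc k)"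
    by eventually_elim (auto intro!: arg_bound_near simp del: of_nat_Suc)
qed simp

lemma phi_le_phi_left: "x < y \<Longrightarrow> \<phi> x \<le> \<phi>\<^sub>l y"
  by (rule tendsto_lowerbound[OF phi_tendsto_left])
    (auto intro!: eventually_mono[OF eventually_at_left_real[of x y]] phi_mono)

lemma phi_left_leI:
  assumes "\<And>x. x < y \<Longrightarrow> \<phi> x \<le> c"
  shows "\<phi>\<^sub>l y \<le> c"
  by (rule tendsto_upperbound[OF phi_tendsto_left])
    (auto intro!: eventually_mono[OF eventually_at_left_real[of "y - 1" y]] assms)

lemma a_par_eq: "a_par lam d \<delta> \<rho> \<alpha> = \<phi> \<alpha>"
  by (simp add: a_par_def phi_def psi_def)

text \<open>Increasing \<open>r\<close> moves every argument \<open>\<alpha> - k * r\<close> to the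
  left, so a right limit in the rotation number becomes a left limit of the summands.\<close>

lemma a_par_right_eq: "a_par_right lam d \<delta> \<rho> \<alpha> = \<phi>\<^sub>l \<alpha>"
proof -
  have eq: "(\<lambda>r. a_par lam d \<delta> r \<alpha>) =
      (\<lambda>r. \<delta> / (1 - lam) + 1 / lam * (\<Sum>k. lam ^ Suc k * \<psi> (\<alpha> - real (Suc k) * r)))"
    by (simp add: a_par_def psi_def fun_eq_iff)
  have "((\<lambda>r. a_par lam d \<delta> r \<alpha>) \<longlongrightarrow> \<phi>\<^sub>l \<alpha>) (at_right \<rho>)"
    unfolding eq phi_left_def
  proof (intro tendsto_intros psi_series_tendsto[where C = "\<bar>\<alpha>\<bar>"])
    fix k
    let ?n = "real (Suc k)"
    obtain b where b: "b < \<alpha> - ?n * \<rho>"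
      "\<And>t. b < t \<Longrightarrow> t < \<alpha> - ?n * \<rho> \<Longrightarrow> \<psi> t = - psi lam d (1 - \<alpha>) (- (\<alpha> - ?n * \<rho>)) - (1 - lam - d)"
      using psi_at_left[OF alpha, of "\<alpha> - ?n * \<rho>"] unfolding eventually_at_left_field by blast
    have "\<forall>\<^sub>F r in at_right \<rho>. r \<in> {\<rho><..<(\<alpha> - b) / ?n}"
      using b(1) by (intro eventually_at_right_real) (simp add: field_simps)
    then show "\<forall>\<^sub>F r in at_right \<rho>. \<psi> (\<alpha> - ?n * r) = - psi lam d (1 - \<alpha>) (?n * \<rho> - \<alpha>) - (1 - lam - d)"
    proof eventually_elim
      case (elim r)
      have "?n * \<rho> < ?n * r"
        using elim by (intro mult_strict_left_mono) auto
      moreover have "?n * r < \<alpha> - b"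
        using elim by (simp add: field_simps)
      ultimately show ?case
        using b(2)[of "\<alpha> - ?n * r"] by simp
    qed
  next
    have "\<forall>\<^sub>F r in at_right \<rho>. r \<in> {\<rho><..<1}"
      using rho by (intro eventually_at_right_real) simp
    then show "\<forall>\<^sub>F r in at_right \<rho>. \<forall>k. \<bar>\<alpha> - real (Suc k) * r\<bar> \<le> \<bar>\<alpha>\<bar> + real (Suc k)"
      by eventually_elim (use rho in \<open>auto intro!: arg_bound simp del: of_nat_Suc\<close>)
  qed simp
  then show ?thesis
    unfolding a_par_right_def by (intro tendsto_Lim) auto
qed

lemma delta_par_series: "delta_par lam d r \<alpha> = 1 - lam - d + (1 - lam) / lam *
    (\<Sum>k. lam ^ Suc k * psi lam d (1 - \<alpha>) (real (Suc k) * r))"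
  by (simp add: delta_par_def psi_def)

text \<open>Both \<open>\<delta>\<close> and \<open>(1 - lam) * \<phi>\<^sub>l 0\<close> change
  equally with \<open>\<delta>\<close>, so their difference is independent of it. Hence an upper
  bound on \<open>\<delta>\<close> becomes a sign condition on the left limit at 0.\<close>

lemma delta_par_eq: "delta_par lam d \<rho> \<alpha> = \<delta> - (1 - lam) * \<phi>\<^sub>l 0"
proof -
  have s: "summable (\<lambda>k. lam ^ Suc k * psi lam d (1 - \<alpha>) (real (Suc k) * \<rho>))" (is "summable ?t")
    using arg_bound[of \<rho> 0] rho by (intro psi_series_summable[of _ 0]) auto
  have "(\<lambda>k. - ?t k - lam ^ Suc k * (1 - lam - d)) sums
      (- (\<Sum>k. ?t k) - lam / (1 - lam) * (1 - lam - d))"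
    by (intro sums_diff sums_minus sums_mult2 weights_sums summable_sums s)
  then have "\<phi>\<^sub>l 0 = \<delta> / (1 - lam) + 1 / lam * (- (\<Sum>k. ?t k) - lam / (1 - lam) * (1 - lam - d))"
    unfolding phi_left_def by (simp add: sums_iff right_diff_distrib)
  then have "(1 - lam) * \<phi>\<^sub>l 0 = \<delta> - (1 - lam) / lam * (\<Sum>k. ?t k) - (1 - lam - d)"
    by (simp only: scale_series scale_weights)
  then show ?thesis
    unfolding delta_par_series by simp
qed

text \<open>A left limit in the rotation number is a left limit of each summand, which turns the
  threshold \<open>1 - \<alpha>\<close> back into \<open>\<alpha>\<close> and so yields
  \<open>\<phi> 0\<close> in place of its left limit.\<close>

lemma delta_par_left_eq: "delta_par_left lam d \<rho> \<alpha> = \<delta> - (1 - lam) * \<phi> 0"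
proof -
  let ?t = "\<lambda>k. lam ^ Suc k * \<psi> (0 - real (Suc k) * \<rho>)"
  let ?l = "\<lambda>k. - \<psi> (- (real (Suc k) * \<rho>)) - (1 - lam - d)"
  have "(\<lambda>k. - ?t k - lam ^ Suc k * (1 - lam - d)) sums
      (- (\<Sum>k. ?t k) - lam / (1 - lam) * (1 - lam - d))"
    by (intro sums_diff sums_minus sums_mult2 weights_sums summable_sums phi_summable)
  then have l: "(\<Sum>k. lam ^ Suc k * ?l k) = - (\<Sum>k. ?t k) - lam / (1 - lam) * (1 - lam - d)"
    by (simp add: sums_iff right_diff_distrib)
  have "((\<lambda>r. delta_par lam d r \<alpha>) \<longlongrightarrow> 1 - lam - d + (1 - lam) / lam * (\<Sum>k. lam ^ Suc k * ?l k)) (at_left \<rho>)"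
    unfolding delta_par_series
  proof (intro tendsto_intros psi_series_tendsto[where C = 0])
    fix k
    let ?n = "real (Suc k)"
    obtain b where b: "b < ?n * \<rho>"
      "\<And>t. b < t \<Longrightarrow> t < ?n * \<rho> \<Longrightarrow> psi lam d (1 - \<alpha>) t = ?l k"
      using psi_at_left[of "1 - \<alpha>" "?n * \<rho>"] alpha unfolding eventually_at_left_field by auto
    have "\<forall>\<^sub>F r in at_left \<rho>. r \<in> {b / ?n<..<\<rho>}"
      using b(1) by (intro eventually_at_left_real) (simp add: field_simps)
    then show "\<forall>\<^sub>F r in at_left \<rho>. psi lam d (1 - \<alpha>) (?n * r) = ?l k"
    proof eventually_elim
      case (elim r)
      have "?n * r < ?n * \<rho>"
        using elim by (intro mult_strict_left_mono) auto
      moreover have "b < ?n * r"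
        using elim by (simp add: field_simps)
      ultimately show ?case
        by (intro b(2))
    qed
  next
    have "\<forall>\<^sub>F r in at_left \<rho>. r \<in> {0<..<\<rho>}"
      using rho by (intro eventually_at_left_real) simp
    then show "\<forall>\<^sub>F r in at_left \<rho>. \<forall>k. \<bar>real (Suc k) * r\<bar> \<le> 0 + real (Suc k)"
    proof eventually_elim
      case (elim r)
      then show ?case using arg_bound[of r 0] rho by simp
    qed
  qed simp
  then have "delta_par_left lam d \<rho> \<alpha> = 1 - lam - d + (1 - lam) / lam * (\<Sum>k. lam ^ Suc k * ?l k)"
    unfolding delta_par_left_def by (intro tendsto_Lim) auto
  moreover have "(1 - lam) * \<phi> 0 = \<delta> + (1 - lam) / lam * (\<Sum>k. ?t k)"
    unfolding phi_def by (rule scale_series)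
  ultimately show ?thesis
    unfolding l scale_weights by simp
qed

end

section \<open>Codes and iterates of the rotation\<close>

lemma theta_eq_iff: "theta b u = theta c v \<longleftrightarrow> (b \<le> u \<longleftrightarrow> c \<le> v)"
  by (auto simp: theta_def)

lemma frac_frac_add: "frac (frac u + v) = frac (u + v)" for u v :: real
proof -
  have "\<lfloor>frac u + v\<rfloor> = \<lfloor>u + v\<rfloor> - \<lfloor>u\<rfloor>"
    by (simp add: frac_def algebra_simps floor_eq_iff)
  then show ?thesis
    by (simp add: frac_def)
qed

lemma rotation_unit: "0 \<le> rotation \<rho> y" "rotation \<rho> y < 1"
  by (simp_all add: rotation_def frac_lt_1)

lemma rotation_funpow:
  assumes "0 \<le> y" "y < 1"
  shows "(rotation \<rho> ^^ n) y = frac (y + real n * \<rho>)"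
proof (induction n)
  case 0
  then show ?case using assms by (simp add: frac_eq)
next
  case (Suc n)
  then show ?case
    by (simp add: rotation_def frac_frac_add algebra_simps)
qed

lemma rotation_funpow_unit:
  assumes "0 \<le> y" "y < 1"
  shows "0 \<le> (rotation \<rho> ^^ n) y" "(rotation \<rho> ^^ n) y < 1"
  by (simp_all add: rotation_funpow[OF assms] frac_lt_1)

lemma rotation_funpow_frac:
  "(rotation \<rho> ^^ n) (frac (z - real n * \<rho>)) = frac z"
  by (simp add: rotation_funpow frac_lt_1 frac_frac_add)

lemma f_map_unit: "0 \<le> f_map lam d \<delta> a x" "f_map lam d \<delta> a x < 1"
  by (simp_all add: f_map_def frac_lt_1)

section \<open>Strict growth and plateaus of \<open>\<phi>\<close>\<close>

context coding
begin

text \<open>Density of the fractional parts of the positive multiples of an irrational number; the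
  multiplier has to be positive because only such points are jumps of \<open>\<phi>\<close>.\<close>

lemma irrational_jump_between:
  assumes "\<rho> \<notin> \<rat>" "x < y"
  obtains k m where "x < of_int m + real (Suc k) * \<rho>" "of_int m + real (Suc k) * \<rho> < y"
proof -
  obtain h k :: int where "k > 0" and hk: "\<bar>of_int k * \<rho> - of_int h - (x + y) / 2\<bar> < (y - x) / 2"
    using sequence_of_fractional_parts_is_dense[OF assms(1), of "(y - x) / 2" "(x + y) / 2"] assms(2)
    by (metis diff_gt_0_iff_gt half_gt_zero)
  then have "real (Suc (nat (k - 1))) = of_int k"
    by (simp add: of_nat_nat)
  moreover have "x < of_int k * \<rho> - of_int h" "of_int k * \<rho> - of_int h < y"
    using hk unfolding abs_less_iff by (simp_all add: field_simps)
  ultimately show thesis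
    using that[of "- h" "nat (k - 1)"] by simp
qed

lemma gap_pos: "0 < lam ^ k * (1 - lam - d)" "0 < lam ^ k * d"
  using lam d by simp_all

lemma phi_strict_irrational:
  assumes "\<rho> \<notin> \<rat>" "x < y"
  shows "\<phi> x < \<phi> y"
proof -
  obtain k m where km: "x < of_int m + real (Suc k) * \<rho>" "of_int m + real (Suc k) * \<rho> < y"
    using irrational_jump_between[OF assms] .
  have "\<phi> x < \<phi> (of_int m + real (Suc k) * \<rho>)"
    using phi_gap_int[OF km(1) refl] gap_pos(1)[of k] by linarith
  also have "\<dots> \<le> \<phi> y"
    using km(2) by (intro phi_mono) simp
  finally show ?thesis .
qed

text \<open>For \<open>\<rho> = p / q\<close> all jumps lie on the multiples of \<open>1 / q\<close>
  and on their translates by \<open>\<alpha>\<close>, and the floors record the position relative to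
  these two lattices.\<close>

lemma phi_eq_rational:
  fixes p :: int and q :: nat
  assumes q: "0 < q" "\<rho> = of_int p / real q"
    and "\<lfloor>real q * x\<rfloor> = \<lfloor>real q * y\<rfloor>" "\<lfloor>real q * (x - \<alpha>)\<rfloor> = \<lfloor>real q * (y - \<alpha>)\<rfloor>"
  shows "\<phi> x = \<phi> y"
proof -
  have iff: "of_int m + real (Suc k) * \<rho> \<le> u \<longleftrightarrow> int q * m + int (Suc k) * p \<le> \<lfloor>real q * u\<rfloor>" for u m k
  proof -
    have "of_int m + real (Suc k) * \<rho> \<le> u \<longleftrightarrow> real q * (of_int m + real (Suc k) * \<rho>) \<le> real q * u"
      using q(1) by (simp only: mult_le_cancel_left_pos of_nat_0_less_iff)
    also have "real q * (of_int m + real (Suc k) * \<rho>) = of_int (int q * m + int (Suc k) * p)"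
      using q by (simp add: field_simps)
    finally show ?thesis
      by (simp only: le_floor_iff)
  qed
  have iff': "\<alpha> + of_int m + real (Suc k) * \<rho> \<le> u \<longleftrightarrow> of_int m + real (Suc k) * \<rho> \<le> u - \<alpha>" for u m k
    by linarith
  show ?thesis
    by (rule phi_eqI) (simp_all only: iff iff' assms(3,4))
qed

text \<open>\<open>y\<^sub>0\<close> is the last point left of \<open>y\<close> on the two lattices
  carrying the jumps. Nonstrict comparison with \<open>y\<^sub>0\<close> then replaces strict
  comparison with \<open>y\<close>, so \<open>y\<^sub>0\<close> stands for the left side of
  \<open>y\<close>.\<close>

lemma rational_left_window:
  assumes "\<rho> \<in> \<rat>"
  obtains y\<^sub>0 where "y\<^sub>0 < y"
    "\<And>k m. of_int m + real k * \<rho> \<le> y\<^sub>0 \<longleftrightarrow> of_int m + real k * \<rho> < y"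
    "\<And>k m. \<alpha> + of_int m + real k * \<rho> \<le> y\<^sub>0 \<longleftrightarrow> \<alpha> + of_int m + real k * \<rho> < y"
proof -
  obtain p :: int and q :: nat where q: "0 < q" "\<rho> = of_int p / real q"
    using assms unfolding Rats_eq_int_div_nat by auto
  define l where "l u = of_int (\<lceil>real q * u\<rceil> - 1) / real q" for u
  have l_less: "l u < u" for u
  proof -
    have "of_int (\<lceil>real q * u\<rceil> - 1) < real q * u" by linarith
    then show ?thesis using q(1) by (simp add: l_def pos_divide_less_eq mult.commute)
  qed
  have le_l: "of_int m + real k * \<rho> \<le> l u" if "of_int m + real k * \<rho> < u" for u m k
  proof -
    have eq: "real q * (of_int m + real k * \<rho>) = of_int (int q * m + int k * p)"
      using q by (simp add: field_simps)
    have "real q * (of_int m + real k * \<rho>) < real q * u"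
      using that q(1) by simp
    then have "int q * m + int k * p \<le> \<lceil>real q * u\<rceil> - 1"
      unfolding eq by linarith
    then have "real q * (of_int m + real k * \<rho>) \<le> of_int (\<lceil>real q * u\<rceil> - 1)"
      unfolding eq of_int_le_iff .
    then show ?thesis
      using q(1) by (simp add: l_def pos_le_divide_eq mult.commute)
  qed
  define y\<^sub>0 where "y\<^sub>0 = max (l y) (\<alpha> + l (y - \<alpha>))"
  have lt: "y\<^sub>0 < y"
    using l_less[of y] l_less[of "y - \<alpha>"] by (simp add: y\<^sub>0_def)
  have "of_int m + real k * \<rho> \<le> y\<^sub>0" if "of_int m + real k * \<rho> < y" for m k
    using le_l[OF that] by (simp add: y\<^sub>0_def)
  moreover have "\<alpha> + of_int m + real k * \<rho> \<le> y\<^sub>0" if "\<alpha> + of_int m + real k * \<rho> < y" for m k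
    using le_l[of m k "y - \<alpha>"] that by (simp add: y\<^sub>0_def le_max_iff_disj)
  ultimately show thesis
    using lt by (intro that[of y\<^sub>0]) force+
qed

lemma phi_locally_constant_left:
  assumes "\<rho> \<in> \<rat>"
  obtains y\<^sub>0 where "y\<^sub>0 < y" "\<And>x. y\<^sub>0 \<le> x \<Longrightarrow> x < y \<Longrightarrow> \<phi> x = \<phi> y\<^sub>0"
proof -
  obtain y\<^sub>0 where y0: "y\<^sub>0 < y"
    "\<And>k m. of_int m + real k * \<rho> \<le> y\<^sub>0 \<longleftrightarrow> of_int m + real k * \<rho> < y"
    "\<And>k m. \<alpha> + of_int m + real k * \<rho> \<le> y\<^sub>0 \<longleftrightarrow> \<alpha> + of_int m + real k * \<rho> < y"
    by (rule rational_left_window[OF assms, of y]) blast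
  have "\<phi> x = \<phi> y\<^sub>0" if "y\<^sub>0 \<le> x" "x < y" for x
    by (rule phi_eqI; meson y0(2,3) that le_less_trans order_trans)
  then show thesis
    using that y0(1) by blast
qed

text \<open>The origin of the extra condition for rational \<open>\<rho>\<close>: there
  \<open>\<phi>\<close> is constant just left of \<open>y\<close> and attains its left limit, so
  equality with \<open>c\<close> is excluded. For irrational \<open>\<rho>\<close> strict growth
  keeps \<open>\<phi>\<close> below the limit.\<close>

lemma phi_below_threshold_iff:
  "(\<forall>x<y. \<phi> x < c) \<longleftrightarrow> \<phi>\<^sub>l y \<le> c \<and> (\<rho> \<in> \<rat> \<longrightarrow> \<phi>\<^sub>l y \<noteq> c)"
proof (cases "\<rho> \<in> \<rat>")
  case True
  obtain y\<^sub>0 where y0: "y\<^sub>0 < y" "\<And>x. y\<^sub>0 \<le> x \<Longrightarrow> x < y \<Longrightarrow> \<phi> x = \<phi> y\<^sub>0"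
    using phi_locally_constant_left[OF True, of y] by metis
  have le: "\<phi> x \<le> \<phi> y\<^sub>0" if "x < y" for x
    using that y0(2)[of x] phi_mono[of x y\<^sub>0] by (cases "y\<^sub>0 \<le> x") auto
  then have "\<phi>\<^sub>l y = \<phi> y\<^sub>0"
    using phi_le_phi_left[OF y0(1)] phi_left_leI[of y "\<phi> y\<^sub>0"] by force
  then show ?thesis
    using True le y0(1) by force
next
  case False
  have "\<phi> x < c" if "\<phi>\<^sub>l y \<le> c" "x < y" for x
    using phi_strict_irrational[OF False, of x "(x + y) / 2"] phi_le_phi_left[of "(x + y) / 2" y] that
    by simp
  then show ?thesis
    using False phi_left_leI[of y c] by force
qed

lemma phi_rotation:
  "\<phi> (rotation \<rho> y) = \<phi> (y + \<rho>) - of_int \<lfloor>y + \<rho>\<rfloor>"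
  using phi_shift[of "y + \<rho>" "- \<lfloor>y + \<rho>\<rfloor>"] by (simp add: rotation_def frac_def)

end

subsection \<open>The three equivalent conditions\<close>

locale coded_map = coding +
  fixes a :: real
  assumes a: "0 \<le> a" "a \<le> 1" and delta: "1 - lam - d < \<delta>" "\<delta> < 1"
begin

abbreviation F :: "real \<Rightarrow> real" where "F \<equiv> lift_F lam d \<delta> a"
abbreviation f :: "real \<Rightarrow> real" where "f \<equiv> f_map lam d \<delta> a"
abbreviation R :: "real \<Rightarrow> real" where "R \<equiv> rotation \<rho>"

text \<open>The common form of the three conditions. It quantifies over all reals, so that it can be
  used along lifted orbits.\<close>

definition matched :: bool where
  "matched \<longleftrightarrow> (\<forall>y. (0 \<le> \<phi> y \<longleftrightarrow> 0 \<le> y) \<and> (a \<le> \<phi> y \<longleftrightarrow> \<alpha> \<le> y))"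

lemma lift_psi: "F x = lam * x + \<delta> + psi lam d a x"
  by (simp add: lift_F_def psi_def)

lemma lift_shift: "F (x + of_int m) = F x + of_int m"
  by (simp add: lift_psi psi_shift algebra_simps)

lemma lift_strict_mono: "x < y \<Longrightarrow> F x < F y"
  using psi_mono[of x y a] lam by (simp add: lift_psi add_less_le_mono)

lemma matched_iff_thresholds:
  "matched \<longleftrightarrow> (\<forall>x<0. \<phi> x < 0) \<and> 0 \<le> \<phi> 0 \<and> (\<forall>x<\<alpha>. \<phi> x < a) \<and> a \<le> \<phi> \<alpha>"
  unfolding matched_def by (meson leD leI order_refl order_trans phi_mono)

text \<open>The bounds on \<open>\<delta>\<close> are sign conditions on \<open>\<phi>\<close> and
  its left limit at 0; the bounds on \<open>a\<close> compare it with the value and the left limit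
  at \<open>\<alpha>\<close>.\<close>

lemma parameter_condition_iff_matched: "parameter_condition lam d \<delta> a \<rho> \<alpha> \<longleftrightarrow> matched"
proof -
  have "\<delta> - (1 - lam) * \<phi> 0 \<le> \<delta> \<longleftrightarrow> 0 \<le> \<phi> 0" "\<delta> \<le> \<delta> - (1 - lam) * \<phi>\<^sub>l 0 \<longleftrightarrow> \<phi>\<^sub>l 0 \<le> 0"
    "\<delta> = \<delta> - (1 - lam) * \<phi>\<^sub>l 0 \<longleftrightarrow> \<phi>\<^sub>l 0 = 0"
    using lam by (auto simp: zero_le_mult_iff mult_le_0_iff)
  then show ?thesis
    unfolding matched_iff_thresholds parameter_condition_def phi_below_threshold_iff
      a_par_eq a_par_right_eq delta_par_eq delta_par_left_eq
    by auto
qed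

lemma matched_iff_unit:
  "matched \<longleftrightarrow> (\<forall>y\<in>{0..<1}. 0 \<le> \<phi> y \<and> \<phi> y < 1 \<and> (a \<le> \<phi> y \<longleftrightarrow> \<alpha> \<le> y))"
proof
  assume m: matched
  show "\<forall>y\<in>{0..<1}. 0 \<le> \<phi> y \<and> \<phi> y < 1 \<and> (a \<le> \<phi> y \<longleftrightarrow> \<alpha> \<le> y)"
  proof
    fix y :: real assume y: "y \<in> {0..<1}"
    have "\<phi> (y - 1) = \<phi> y - 1"
      using phi_shift[of y "-1"] by simp
    moreover have "\<phi> (y - 1) < 0"
      using m y unfolding matched_def by (meson atLeastLessThan_iff diff_ge_0_iff_ge not_le)
    ultimately show "0 \<le> \<phi> y \<and> \<phi> y < 1 \<and> (a \<le> \<phi> y \<longleftrightarrow> \<alpha> \<le> y)"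
      using m y by (auto simp: matched_def)
  qed
next
  assume u: "\<forall>y\<in>{0..<1}. 0 \<le> \<phi> y \<and> \<phi> y < 1 \<and> (a \<le> \<phi> y \<longleftrightarrow> \<alpha> \<le> y)"
  have neg: "\<phi> y < 0" if "y < 0" for y
  proof -
    have "\<phi> (frac y) < 1" using u by (simp add: frac_lt_1)
    moreover have "\<phi> (frac y) = \<phi> y - of_int \<lfloor>y\<rfloor>"
      using phi_shift[of y "- \<lfloor>y\<rfloor>"] by (simp add: frac_def)
    moreover have "\<lfloor>y\<rfloor> \<le> -1" using that by linarith
    then have "real_of_int \<lfloor>y\<rfloor> \<le> -1" by linarith
    ultimately show ?thesis by linarith
  qed
  \<comment> \<open>If \<open>\<alpha> = 1\<close>, the hypothesis does not reach
    \<open>\<alpha>\<close>; degree one then gives \<open>a \<le> 1 \<le> \<phi> 1\<close>.\<close>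
  have "\<phi> 1 = \<phi> 0 + 1"
    using phi_shift[of 0 1] by simp
  moreover have "0 \<le> \<phi> 0"
    using u by simp
  ultimately have "a \<le> \<phi> 1"
    using a by linarith
  then have "a \<le> \<phi> \<alpha>"
    using u alpha by (cases "\<alpha> = 1") auto
  moreover have "\<phi> x < a" if "x < \<alpha>" for x
  proof (cases "x < 0")
    case True
    then show ?thesis using neg[of x] a by linarith
  next
    case False
    then have "x \<in> {0..<1}" using that alpha by auto
    then have "a \<le> \<phi> x \<longleftrightarrow> \<alpha> \<le> x" using u by blast
    then show ?thesis using that by linarith
  qed
  ultimately show matched
    using u neg by (auto simp: matched_iff_thresholds)
qed

lemma matched_shift:
  assumes matched
  shows "of_int m \<le> \<phi> y \<longleftrightarrow> of_int m \<le> y" "a + of_int m \<le> \<phi> y \<longleftrightarrow> \<alpha> + of_int m \<le> y"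
  using assms phi_shift[of y "- m"] unfolding matched_def
  by (smt (verit) of_int_minus)+

lemma matched_psi: "matched \<Longrightarrow> psi lam d a (\<phi> y) = \<psi> y"
  by (intro psi_eqI matched_shift)

lemma matched_lift: "matched \<Longrightarrow> F (\<phi> y) = \<phi> (y + \<rho>)"
  by (simp add: lift_psi matched_psi phi_rec)

lemma matched_unit:
  assumes matched "0 \<le> y" "y < 1"
  shows "0 \<le> \<phi> y" "\<phi> y < 1"
  using assms by (auto simp: matched_iff_unit)

lemma matched_semiconjugacy:
  assumes matched
  shows "f (\<phi> y) = \<phi> (R y)"
proof -
  have "0 \<le> \<phi> (R y)" "\<phi> (R y) < 1"
    using assms rotation_unit[of \<rho> y] by (auto simp: matched_iff_unit)
  then show ?thesis
    unfolding f_map_def matched_lift[OF assms] phi_rotation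
    by (subst frac_unique_iff) auto
qed

lemma matched_orbit:
  assumes matched
  shows "(f ^^ n) (\<phi> y) = \<phi> ((R ^^ n) y)"
  by (induction n) (simp_all add: matched_semiconjugacy[OF assms])

text \<open>For the forward direction, \<open>F (\<phi> y)\<close> and
  \<open>\<phi> (y + \<rho>)\<close> differ by an integer, but also by \<open>d\<close> times the
  difference of two codes. As \<open>d < 1\<close>, the integer is 0 and the codes agree.\<close>

lemma semiconjugacy_condition_iff_matched: "semiconjugacy_condition lam d \<delta> a \<rho> \<alpha> \<longleftrightarrow> matched"
proof
  assume s: "semiconjugacy_condition lam d \<delta> a \<rho> \<alpha>"
  then have unit: "0 \<le> \<phi> y" "\<phi> y < 1" if "y \<in> {0..<1}" for y
    using that unfolding semiconjugacy_condition_def image_subset_iff atLeastLessThan_iff by simp_all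
  have "a \<le> \<phi> y \<longleftrightarrow> \<alpha> \<le> y" if y: "y \<in> {0..<1}" for y
  proof -
    have "frac (F (\<phi> y)) = \<phi> (R y)"
      using s y by (auto simp: semiconjugacy_condition_def f_map_def)
    then have "F (\<phi> y) - \<phi> (y + \<rho>) = of_int (\<lfloor>F (\<phi> y)\<rfloor> - \<lfloor>y + \<rho>\<rfloor>)"
      by (simp add: frac_def phi_rotation)
    moreover have "F (\<phi> y) - \<phi> (y + \<rho>) = d * (theta a (\<phi> y) - theta \<alpha> y)"
    proof -
      have "\<lfloor>\<phi> y\<rfloor> = 0" "\<lfloor>y\<rfloor> = 0"
        using y unit[OF y] by (simp_all add: floor_eq_iff)
      then show ?thesis
        by (simp add: lift_psi phi_rec psi_def frac_def right_diff_distrib)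
    qed
    ultimately have e: "d * (theta a (\<phi> y) - theta \<alpha> y) = of_int (\<lfloor>F (\<phi> y)\<rfloor> - \<lfloor>y + \<rho>\<rfloor>)" (is "_ = of_int ?j")
      by simp
    have "\<bar>d * (theta a (\<phi> y) - theta \<alpha> y)\<bar> < 1"
      using lam d by (auto simp: theta_def)
    then have "?j = 0"
      unfolding e by linarith
    then have "theta a (\<phi> y) = theta \<alpha> y"
      using e d by simp
    then show ?thesis by (simp add: theta_eq_iff)
  qed
  with unit show matched
    by (auto simp: matched_iff_unit)
next
  assume matched
  then show "semiconjugacy_condition lam d \<delta> a \<rho> \<alpha>"
    by (auto simp: semiconjugacy_condition_def matched_semiconjugacy matched_unit)
qed

section \<open>Where the lift passes the level 1\<close>

lemma lift_unit:
  assumes "0 \<le> x" "x < 1"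
  shows "F x = lam * x + \<delta> + (if x < a then 0 else d)"
  using assms by (simp add: lift_F_def theta_def frac_eq floor_eq_iff)

lemma lift_unit_bounds:
  assumes "0 \<le> x" "x < 1"
  shows "0 \<le> F x" "F x < 2"
proof -
  have "0 \<le> lam * x" "lam * x < lam"
    using assms lam by simp_all
  moreover have "0 \<le> (if x < a then 0 else d)" "(if x < a then 0 else d) \<le> d"
    using d by simp_all
  ultimately show "0 \<le> F x" "F x < 2"
    unfolding lift_unit[OF assms] using lam d delta by linarith+
qed

text \<open>\<open>\<eta>\<close> is the point of \<open>[0,1)\<close> where \<open>F\<close> passes \<open>1\<close>, which \<open>\<phi>\<close> matches with \<open>1 - \<rho>\<close>.\<close>

definition crossing :: "real \<Rightarrow> bool" where
  "crossing \<eta> \<longleftrightarrow> (\<forall>x. 0 \<le> x \<longrightarrow> x < 1 \<longrightarrow> (1 \<le> F x \<longleftrightarrow> \<eta> \<le> x))"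

lemma eta_le_iff: "eta1 lam d \<delta> \<le> x \<longleftrightarrow> 1 \<le> lam * x + \<delta> + d" "eta2 lam \<delta> \<le> x \<longleftrightarrow> 1 \<le> lam * x + \<delta>"
  using lam by (auto simp: eta1_def eta2_def pos_divide_le_eq mult.commute)

text \<open>The three cases say where \<open>F\<close> reaches 1: on its upper branch to the right
  of \<open>a\<close>, by the jump at \<open>a\<close>, or on its lower branch to the left of
  \<open>a\<close>.\<close>

lemma crossing_cases:
  shows "a < eta1 lam d \<delta> \<Longrightarrow> crossing (eta1 lam d \<delta>)"
    and "eta1 lam d \<delta> \<le> a \<Longrightarrow> a \<le> eta2 lam \<delta> \<Longrightarrow> crossing a"
    and "eta2 lam \<delta> < a \<Longrightarrow> crossing (eta2 lam \<delta>)"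
proof -
  have mono: "lam * x \<le> lam * y" if "x \<le> y" for x y
    using lam that by simp
  have strict: "lam * x < lam * y" if "x < y" for x y
    using lam that by simp
  show "crossing (eta1 lam d \<delta>)" if "a < eta1 lam d \<delta>"
    unfolding crossing_def
  proof (intro allI impI)
    fix x :: real assume x: "0 \<le> x" "x < 1"
    show "1 \<le> F x \<longleftrightarrow> eta1 lam d \<delta> \<le> x"
      using that strict[of x a] d unfolding lift_unit[OF x] eta_le_iff not_le[symmetric]
      by (auto simp: not_le)
  qed
  show "crossing a" if "eta1 lam d \<delta> \<le> a" "a \<le> eta2 lam \<delta>"
    unfolding crossing_def
  proof (intro allI impI)
    fix x :: real assume x: "0 \<le> x" "x < 1"
    have "\<not> eta2 lam \<delta> \<le> x" if "x < a"
      using that \<open>a \<le> eta2 lam \<delta>\<close> by linarith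
    moreover have "eta1 lam d \<delta> \<le> x" if "a \<le> x"
      using that \<open>eta1 lam d \<delta> \<le> a\<close> by linarith
    ultimately show "1 \<le> F x \<longleftrightarrow> a \<le> x"
      unfolding lift_unit[OF x] eta_le_iff by auto
  qed
  show "crossing (eta2 lam \<delta>)" if "eta2 lam \<delta> < a"
    unfolding crossing_def
  proof (intro allI impI)
    fix x :: real assume x: "0 \<le> x" "x < 1"
    have "eta2 lam \<delta> \<le> x" if "a \<le> x"
      using that \<open>eta2 lam \<delta> < a\<close> by linarith
    then show "1 \<le> F x \<longleftrightarrow> eta2 lam \<delta> \<le> x"
      unfolding lift_unit[OF x] eta_le_iff using d by auto
  qed
qed

text \<open>Since \<open>a\<close> lies in \<open>[0,1]\<close>,
  \<open>a < eta1 lam d \<delta>\<close> forces \<open>\<delta> < 1 - d\<close>, and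
  \<open>eta2 lam \<delta> < a\<close> forces \<open>1 - lam < \<delta>\<close>.\<close>

lemma in_M_iff:
  "(\<delta>, a) \<in> M1 lam d \<longleftrightarrow> a < eta1 lam d \<delta>"
  "(\<delta>, a) \<in> M2 lam d \<longleftrightarrow> eta1 lam d \<delta> \<le> a \<and> a \<le> eta2 lam \<delta>"
  "(\<delta>, a) \<in> M3 lam \<longleftrightarrow> eta2 lam \<delta> < a"
proof -
  have "\<delta> < 1 - d" if "a < eta1 lam d \<delta>"
  proof -
    have "0 < eta1 lam d \<delta>" using that a by linarith
    then show ?thesis using lam by (simp add: eta1_def zero_less_divide_iff)
  qed
  then show "(\<delta>, a) \<in> M1 lam d \<longleftrightarrow> a < eta1 lam d \<delta>"
    using a delta by (auto simp: M1_def)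
  show "(\<delta>, a) \<in> M2 lam d \<longleftrightarrow> eta1 lam d \<delta> \<le> a \<and> a \<le> eta2 lam \<delta>"
    using a delta by (auto simp: M2_def)
  have "1 - lam < \<delta>" if "eta2 lam \<delta> < a"
  proof -
    have "eta2 lam \<delta> < 1" using that a by linarith
    then show ?thesis using lam by (simp add: eta2_def pos_divide_less_eq)
  qed
  then show "(\<delta>, a) \<in> M3 lam \<longleftrightarrow> eta2 lam \<delta> < a"
    using a delta by (auto simp: M3_def)
qed

text \<open>\<open>F (\<phi> y) = \<phi> (y + \<rho>)\<close> is at least 1 exactly when
  \<open>y + \<rho>\<close> is.\<close>

lemma matched_crossing:
  assumes matched "crossing \<eta>" "0 \<le> y" "y < 1"
  shows "\<eta> \<le> \<phi> y \<longleftrightarrow> 1 - \<rho> \<le> y"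
proof -
  have "\<eta> \<le> \<phi> y \<longleftrightarrow> 1 \<le> F (\<phi> y)"
    using assms matched_unit by (simp add: crossing_def)
  also have "\<dots> \<longleftrightarrow> 1 \<le> y + \<rho>"
    using matched_shift(1)[OF assms(1), of 1 "y + \<rho>"] by (simp add: matched_lift[OF assms(1)])
  finally show ?thesis by linarith
qed

text \<open>\<open>\<phi>\<close> matches \<open>a\<close> with \<open>\<alpha>\<close> and
  \<open>\<eta>\<close> with \<open>1 - \<rho>\<close>, so the order of \<open>a\<close> and
  \<open>\<eta>\<close> determines that of \<open>\<alpha>\<close> and
  \<open>1 - \<rho>\<close>.\<close>

lemma matched_imp_coding:
  assumes m: matched
  shows "coding_condition lam d \<delta> a \<rho> \<alpha>"
proof -
  have code: "\<forall>y\<in>{0..<1}. \<forall>n. theta a ((f ^^ n) (\<phi> y)) = theta \<alpha> ((R ^^ n) y) \<and>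
      theta \<eta> ((f ^^ n) (\<phi> y)) = theta (1 - \<rho>) ((R ^^ n) y)" if "crossing \<eta>" for \<eta>
    using m matched_crossing[OF m that] rotation_funpow_unit
    by (auto simp: matched_orbit theta_eq_iff matched_def)
  have ai: "a \<le> \<phi> y \<longleftrightarrow> \<alpha> \<le> y" for y
    using m by (simp add: matched_def)
  consider "a < eta1 lam d \<delta>" | "eta1 lam d \<delta> \<le> a" "a \<le> eta2 lam \<delta>" | "eta2 lam \<delta> < a"
    by linarith
  then show ?thesis
  proof cases
    case 1
    have "eta1 lam d \<delta> \<le> \<phi> (1 - \<rho>)"
      using matched_crossing[OF m crossing_cases(1)[OF 1], of "1 - \<rho>"] rho by simp
    then have "\<alpha> \<le> 1 - \<rho>" using 1 ai[of "1 - \<rho>"] by linarith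
    then show ?thesis
      using 1 code[OF crossing_cases(1)[OF 1]] alpha
      unfolding coding_condition_def by (intro exI[of _ "eta1 lam d \<delta>"]) (auto simp: in_M_iff)
  next
    case 2
    note c = crossing_cases(2)[OF 2]
    have "\<alpha> \<le> 1 - \<rho>"
      using matched_crossing[OF m c, of "1 - \<rho>"] rho ai[of "1 - \<rho>"] by simp
    moreover have "1 - \<rho> \<le> \<alpha>"
      using matched_crossing[OF m c, of \<alpha>] alpha rho ai[of \<alpha>] calculation by simp
    ultimately show ?thesis
      using 2 code[OF c] unfolding coding_condition_def
      by (intro exI[of _ a]) (auto simp: in_M_iff)
  next
    case 3
    \<comment> \<open>\<open>matched_crossing\<close> speaks only of points in \<open>[0,1)\<close>,
      hence the separate case \<open>\<alpha> = 1\<close>.\<close>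
    have "1 - \<rho> \<le> \<alpha>"
    proof (cases "\<alpha> = 1")
      case False
      moreover have "eta2 lam \<delta> \<le> \<phi> \<alpha>" using 3 ai[of \<alpha>] by simp
      ultimately show ?thesis
        using matched_crossing[OF m crossing_cases(3)[OF 3], of \<alpha>] alpha by simp
    qed (use rho in simp)
    then show ?thesis
      using 3 code[OF crossing_cases(3)[OF 3]] alpha
      unfolding coding_condition_def by (intro exI[of _ "eta2 lam \<delta>"]) (auto simp: in_M_iff)
  qed
qed

lemma f_unit:
  assumes "crossing \<eta>" "0 \<le> x" "x < 1"
  shows "f x = F x - (if \<eta> \<le> x then 1 else 0)"
proof -
  have "\<lfloor>F x\<rfloor> = (if \<eta> \<le> x then 1 else 0)"
    using assms lift_unit_bounds[OF assms(2,3)]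
    by (intro floor_unique) (auto simp: crossing_def not_le)
  then show ?thesis by (simp add: f_map_def frac_def)
qed

lemma phi_rotation_unit:
  assumes "0 \<le> y" "y < 1"
  shows "\<phi> (R y) = lam * \<phi> y + \<delta> + (if \<alpha> \<le> y then d else 0) - (if 1 - \<rho> \<le> y then 1 else 0)"
proof -
  have "\<lfloor>y + \<rho>\<rfloor> = (if 1 - \<rho> \<le> y then 1 else 0)"
    using assms rho by (intro floor_unique) auto
  moreover have "\<psi> y = (if \<alpha> \<le> y then d else 0)"
    using assms by (simp add: psi_def theta_def frac_eq floor_eq_iff)
  ultimately show ?thesis
    by (simp add: phi_rotation phi_rec)
qed

text \<open>The two orbits obey the same affine recursion as soon as their codes agree, so that their
  distance contracts; going back along the rotation, every value of \<open>\<phi>\<close> is a limit of points of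
  \<open>[0,1)\<close>.\<close>

lemma coding_imp_matched:
  assumes "coding_condition lam d \<delta> a \<rho> \<alpha>"
  shows matched
proof -
  obtain \<eta> where
    M: "a < eta1 lam d \<delta> \<and> \<eta> = eta1 lam d \<delta> \<or>
        (eta1 lam d \<delta> \<le> a \<and> a \<le> eta2 lam \<delta>) \<and> \<alpha> = 1 - \<rho> \<and> \<eta> = a \<or>
        eta2 lam \<delta> < a \<and> \<eta> = eta2 lam \<delta>"
    and code: "\<And>y n. y \<in> {0..<1} \<Longrightarrow> a \<le> (f ^^ n) (\<phi> y) \<longleftrightarrow> \<alpha> \<le> (R ^^ n) y"
      "\<And>y n. y \<in> {0..<1} \<Longrightarrow> \<eta> \<le> (f ^^ n) (\<phi> y) \<longleftrightarrow> 1 - \<rho> \<le> (R ^^ n) y"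
    using assms unfolding coding_condition_def in_M_iff theta_eq_iff by blast
  have cross: "crossing \<eta>"
    using M crossing_cases by auto
  have eta_le: "\<eta> \<le> 1"
  proof -
    have "eta1 lam d \<delta> \<le> 1" using delta by (simp add: eta_le_iff)
    then show ?thesis using M a by auto
  qed
  \<comment> \<open>Otherwise \<open>a = 0\<close> and \<open>\<alpha> = 1 - \<rho>\<close>. The
    rotation takes \<open>1 - \<rho>\<close> to 0, which is below \<open>\<alpha>\<close>, whereas
    no value of \<open>f\<close> is below \<open>a\<close>: the codes differ.\<close>
  have eta_pos: "0 < \<eta>"
  proof (rule ccontr)
    assume "\<not> 0 < \<eta>"
    moreover have "\<not> eta2 lam \<delta> \<le> 0" using delta by (simp add: eta_le_iff)
    ultimately have "a = 0" "\<alpha> = 1 - \<rho>"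
      using M a by auto
    moreover have "(R ^^ 1) (1 - \<rho>) = 0"
      by (simp add: rotation_def)
    ultimately show False
      using code(1)[of "1 - \<rho>" 1] rho f_map_unit[of lam d \<delta> 0 "\<phi> (1 - \<rho>)"] by auto
  qed
  \<comment> \<open>The error is measured after one step: values of \<open>f\<close> lie in
    \<open>[0,1)\<close>, where \<open>f_unit\<close> applies, while \<open>\<phi> y\<close> is not
    yet known to lie there.\<close>
  define D where "D y = f (\<phi> y) - \<phi> (R y)" for y
  have contract: "(f ^^ Suc n) (\<phi> y) - \<phi> ((R ^^ Suc n) y) = lam ^ n * D y" if y: "y \<in> {0..<1}" for y n
  proof (induction n)
    case (Suc n)
    define u where "u = (f ^^ Suc n) (\<phi> y)"
    define v where "v = (R ^^ Suc n) y"
    have u: "0 \<le> u" "u < 1" by (simp_all add: u_def f_map_unit)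
    have v: "0 \<le> v" "v < 1" by (simp_all add: v_def rotation_unit)
    have iff: "a \<le> u \<longleftrightarrow> \<alpha> \<le> v" "\<eta> \<le> u \<longleftrightarrow> 1 - \<rho> \<le> v"
      using code[OF y, of "Suc n"] by (simp_all only: u_def v_def)
    have "f u - \<phi> (R v) = lam * (u - \<phi> v)"
      unfolding f_unit[OF cross u] phi_rotation_unit[OF v] lift_unit[OF u]
      using iff by (auto simp: right_diff_distrib)
    moreover have "u - \<phi> v = lam ^ n * D y"
      using Suc by (simp only: u_def v_def)
    ultimately have "f u - \<phi> (R v) = lam ^ Suc n * D y"
      by simp
    then show ?case
      by (simp add: u_def v_def)
  qed (simp add: D_def)
  define C where "C = 2 + \<bar>\<phi> 0\<bar>"
  have D_bound: "\<bar>D y\<bar> \<le> C" for y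
  proof -
    have "\<phi> 0 \<le> \<phi> (R y)" "\<phi> (R y) \<le> \<phi> 1"
      using rotation_unit[of \<rho> y] by (auto intro: phi_mono)
    moreover have "\<phi> 1 = \<phi> 0 + 1" using phi_shift[of 0 1] by simp
    ultimately show ?thesis
      using f_map_unit[of lam d \<delta> a "\<phi> y"] unfolding D_def C_def by linarith
  qed
  have closed_unit: "0 \<le> \<phi> z \<and> \<phi> z \<le> 1" if z: "z \<in> {0..<1}" for z
  proof -
    have bd: "\<phi> z \<le> 1 + lam ^ n * C" "- \<phi> z \<le> lam ^ n * C" for n
    proof -
      define y where "y = frac (z - real (Suc n) * \<rho>)"
      have "(R ^^ Suc n) y = z"
        unfolding y_def using rotation_funpow_frac[where n = "Suc n"] z by (simp only:) (simp add: frac_eq)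
      moreover have "y \<in> {0..<1}" by (simp add: y_def frac_lt_1)
      ultimately have "(f ^^ Suc n) (\<phi> y) - \<phi> z = lam ^ n * D y"
        using contract by metis
      moreover have "\<bar>lam ^ n * D y\<bar> \<le> lam ^ n * C"
        using D_bound lam by (simp add: abs_mult)
      moreover have "0 \<le> (f ^^ Suc n) (\<phi> y)" "(f ^^ Suc n) (\<phi> y) < 1"
        by (simp_all add: f_map_unit)
      ultimately show "\<phi> z \<le> 1 + lam ^ n * C" "- \<phi> z \<le> lam ^ n * C"
        by linarith+
    qed
    have lim: "(\<lambda>n. lam ^ n * C) \<longlonglongrightarrow> 0"
      using lam by (intro tendsto_mult_left_zero LIMSEQ_power_zero) simp
    have "\<phi> z \<le> 1 + 0"
      by (rule LIMSEQ_le_const[OF tendsto_add[OF tendsto_const lim]]) (use bd in blast)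
    moreover have "- \<phi> z \<le> 0"
      by (rule LIMSEQ_le_const[OF lim]) (use bd in blast)
    ultimately show ?thesis by simp
  qed
  \<comment> \<open>The limit gives only the closed interval. For irrational \<open>\<rho>\<close>,
    a value 1 at \<open>z\<close> would force larger values between \<open>z\<close> and 1.\<close>
  have not_one: "\<phi> z \<noteq> 1" if z: "z \<in> {0..<1}" for z
  proof (cases "\<rho> \<in> \<rat>")
    case False
    have "\<phi> z < \<phi> ((z + 1) / 2)"
      using z by (intro phi_strict_irrational[OF False]) simp
    moreover have "\<phi> ((z + 1) / 2) \<le> 1"
      using closed_unit[of "(z + 1) / 2"] z by simp
    ultimately show ?thesis by simp
  next
    case True
    obtain p :: int and q :: nat where q: "0 < q" "\<rho> = of_int p / real q"
      using True unfolding Rats_eq_int_div_nat by auto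
    show ?thesis
    proof
      assume one: "\<phi> z = 1"
      have "\<alpha> \<le> z" "1 - \<rho> \<le> z"
        using code[OF z, of 0] one a eta_le by simp_all
      \<comment> \<open>On the rotation side the value 1 continues along the upper branch of the
        lift, whereas \<open>f 1 = f 0\<close>; as \<open>lam + d < 1\<close>, the error
        \<open>D z\<close> is positive. After one period the orbit of \<open>f\<close> would thus
        exceed \<open>\<phi> z = 1\<close>, although it stays below 1.\<close>
      then have "\<phi> (R z) = lam + \<delta> + d - 1"
        using phi_rotation_unit[of z] z one by simp
      moreover have "f 1 = f 0"
        using lift_shift[of 0 1] by (simp add: f_map_def frac_def)
      moreover have "f 0 = \<delta> + (if 0 < a then 0 else d)"
        using f_unit[OF cross, of 0] lift_unit[of 0] eta_pos by simp
      ultimately have "0 < D z"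
        using one lam d by (simp add: D_def)
      then have "\<phi> ((R ^^ q) z) < (f ^^ q) (\<phi> z)"
        using contract[OF z, of "q - 1"] q(1) lam
        by (metis Suc_diff_1 diff_gt_0_iff_gt zero_less_mult_iff zero_less_power)
      moreover have "(R ^^ q) z = z"
        using q z by (simp add: rotation_funpow frac_def floor_eq_iff)
      moreover have "(f ^^ q) (\<phi> z) < 1"
        using q(1) f_map_unit by (cases q) auto
      ultimately show False
        using one by simp
    qed
  qed
  have "0 \<le> \<phi> y \<and> \<phi> y < 1 \<and> (a \<le> \<phi> y \<longleftrightarrow> \<alpha> \<le> y)" if "y \<in> {0..<1}" for y
    using closed_unit[OF that] not_one[OF that] code(1)[OF that, of 0] by simp
  then show ?thesis
    by (simp add: matched_iff_unit)
qed

lemma coding_condition_iff_matched: "coding_condition lam d \<delta> a \<rho> \<alpha> \<longleftrightarrow> matched"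
  using coding_imp_matched matched_imp_coding by blast

subsection \<open>Points of the attractor\<close>

lemma image_subset_attractor:
  assumes matched
  shows "\<phi> ` {0..<1} \<subseteq> attractor lam d \<delta> a"
proof -
  have "\<phi> y \<in> (f ^^ n) ` {0..<1}" if y: "0 \<le> y" "y < 1" for y n
  proof
    show "\<phi> (frac (y - real n * \<rho>)) \<in> {0..<1}"
      using matched_unit[OF assms] by (simp add: frac_lt_1)
    show "\<phi> y = (f ^^ n) (\<phi> (frac (y - real n * \<rho>)))"
      using y by (simp add: matched_orbit[OF assms] rotation_funpow_frac frac_eq)
  qed
  then show ?thesis
    by (auto simp: attractor_def)
qed

lemma lift_funpow_shift: "(F ^^ n) (x + of_int m) = (F ^^ n) x + of_int m"
  by (induction n) (simp_all add: lift_shift)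

lemma f_frac: "f (frac u) = frac (F u)"
  using lift_shift[of u "- \<lfloor>u\<rfloor>"] by (simp add: f_map_def frac_def)

lemma f_funpow_lift:
  assumes "0 \<le> x" "x < 1"
  shows "(f ^^ n) x = frac ((F ^^ n) x)"
  by (induction n) (use assms in \<open>simp_all add: f_frac frac_eq\<close>)

lemma strict_mono_lift: "strict_mono F"
  using lift_strict_mono by (rule strict_monoI)

text \<open>Membership in the attractor gives, for each \<open>n\<close>, some \<open>n\<close>-th
  preimage under \<open>f\<close>, moved by an integer to one under \<open>F\<close>. Injectivity of
  \<open>F\<close> makes these separately chosen points fit together.\<close>

lemma attractor_backward_orbit:
  assumes "x \<in> attractor lam d \<delta> a"
  obtains Z :: "nat \<Rightarrow> real" where "Z 0 = x" "\<And>k. F (Z (Suc k)) = Z k"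
proof -
  have "\<exists>z. (F ^^ n) z = x" for n
  proof -
    have "x \<in> (f ^^ n) ` {0..<1}"
      using assms unfolding attractor_def by blast
    then obtain u where u: "0 \<le> u" "u < 1" "x = (f ^^ n) u"
      by auto
    then have "(F ^^ n) (u + of_int (- \<lfloor>(F ^^ n) u\<rfloor>)) = x"
      unfolding lift_funpow_shift by (simp add: f_funpow_lift frac_def)
    then show ?thesis by blast
  qed
  then obtain Z where Z: "\<And>n. (F ^^ n) (Z n) = x"
    by metis
  have "F (Z (Suc k)) = Z k" for k
  proof -
    have "(F ^^ k) (F (Z (Suc k))) = (F ^^ k) (Z k)"
      using Z[of k] Z[of "Suc k"] by (simp add: funpow_swap1)
    then show ?thesis
      using inj_fn[OF strict_mono_imp_inj_on[OF strict_mono_lift], of k] by (simp add: inj_eq)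
  qed
  then show thesis
    using that[of Z] Z[of 0] by simp
qed

text \<open>The cut is the supremum of \<open>{y. \<phi> y \<le> x}\<close>, finite since
  \<open>\<phi>\<close> has degree one. Nothing is claimed at \<open>v\<close> itself, where
  \<open>\<phi>\<close> may jump past \<open>x\<close>.\<close>

lemma phi_cut:
  obtains v where "\<And>y. y < v \<Longrightarrow> \<phi> y \<le> x" "\<And>y. v < y \<Longrightarrow> x < \<phi> y"
proof -
  define S where "S = {y. \<phi> y \<le> x}"
  have "of_int \<lfloor>x - \<phi> 0\<rfloor> \<in> S"
    using phi_shift[of 0 "\<lfloor>x - \<phi> 0\<rfloor>"] unfolding S_def mem_Collect_eq add_0 by linarith
  then have ne: "S \<noteq> {}" by blast
  have top: "y \<le> of_int (\<lfloor>x - \<phi> 0\<rfloor> + 1)" if "y \<in> S" for y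
  proof (rule ccontr)
    assume "\<not> y \<le> of_int (\<lfloor>x - \<phi> 0\<rfloor> + 1)"
    then have "\<phi> (of_int (\<lfloor>x - \<phi> 0\<rfloor> + 1)) \<le> x"
      using phi_mono[of "of_int (\<lfloor>x - \<phi> 0\<rfloor> + 1)" y] that by (simp add: S_def)
    then show False
      using phi_shift[of 0 "\<lfloor>x - \<phi> 0\<rfloor> + 1"] unfolding add_0 by linarith
  qed
  then have bdd: "bdd_above S" by (auto simp: bdd_above_def)
  show thesis
  proof (rule that[of "Sup S"])
    fix y assume "y < Sup S"
    then obtain s where "s \<in> S" "y < s"
      using less_cSup_iff[OF ne bdd] by blast
    then show "\<phi> y \<le> x"
      using phi_mono[of y s] by (simp add: S_def)
  next
    fix y assume "Sup S < y"
    then have "y \<notin> S"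
      using cSup_upper[OF _ bdd] by force
    then show "x < \<phi> y" by (simp add: S_def)
  qed
qed

end

section \<open>Cuts along a backward orbit\<close>

locale backward_orbit = coded_map +
  fixes Z :: "nat \<Rightarrow> real" and v :: real
  assumes matched: matched and orbit: "\<And>k. F (Z (Suc k)) = Z k"
    and below: "\<And>y. y < v \<Longrightarrow> \<phi> y \<le> Z 0" and above: "\<And>y. v < y \<Longrightarrow> Z 0 < \<phi> y"
begin

text \<open>\<open>F\<close> is strictly increasing and acts on values of \<open>\<phi>\<close> as
  the shift by \<open>\<rho>\<close>; hence the cut of \<open>Z k\<close> is
  \<open>v - k * \<rho>\<close>.\<close>

lemma phi_le_orbit_iff: "\<phi> y \<le> Z k \<longleftrightarrow> \<phi> (y + real k * \<rho>) \<le> Z 0"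
proof (induction k arbitrary: y)
  case (Suc k)
  have "\<phi> y \<le> Z (Suc k) \<longleftrightarrow> F (\<phi> y) \<le> F (Z (Suc k))"
    by (simp add: strict_mono_less_eq[OF strict_mono_lift])
  also have "\<dots> \<longleftrightarrow> \<phi> (y + \<rho> + real k * \<rho>) \<le> Z 0"
    unfolding orbit matched_lift[OF matched] by (rule Suc)
  also have "y + \<rho> + real k * \<rho> = y + real (Suc k) * \<rho>"
    by (simp add: algebra_simps)
  finally show ?case .
qed simp

lemma below_orbit: "y < v - real k * \<rho> \<Longrightarrow> \<phi> y \<le> Z k"
  using below[of "y + real k * \<rho>"] phi_le_orbit_iff[of y k] by simp

lemma above_orbit: "v - real k * \<rho> < y \<Longrightarrow> Z k < \<phi> y"
  using above[of "y + real k * \<rho>"] phi_le_orbit_iff[of y k] by (simp add: linorder_not_le)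

lemma orbit_near: "\<bar>Z k - \<phi> (v - real k * \<rho>)\<bar> \<le> 1"
proof -
  have "\<phi> (v - real k * \<rho> - 1) \<le> Z k" "Z k < \<phi> (v - real k * \<rho> + 1)"
    by (simp_all add: below_orbit above_orbit)
  then show ?thesis
    using phi_shift[of "v - real k * \<rho>" 1] phi_shift[of "v - real k * \<rho>" "-1"]
    by (simp add: abs_le_iff)
qed

lemma int_le_orbit_iff:
  assumes "v - real k * \<rho> \<noteq> of_int m"
  shows "of_int m \<le> Z k \<longleftrightarrow> of_int m < v - real k * \<rho>"
proof (cases "of_int m < v - real k * \<rho>")
  case True
  then show ?thesis
    using below_orbit[OF True] matched_shift(1)[OF matched, of m "of_int m"] by simp
next
  case False
  then obtain y where y: "v - real k * \<rho> < y" "y < of_int m"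
    using assms dense[of "v - real k * \<rho>" "of_int m"] by auto
  then have "Z k < of_int m"
    using above_orbit[OF y(1)] matched_shift(1)[OF matched, of m y] by simp
  then show ?thesis using False by simp
qed

lemma threshold_le_orbit_iff:
  assumes "v - real k * \<rho> \<noteq> \<alpha> + of_int m"
  shows "a + of_int m \<le> Z k \<longleftrightarrow> \<alpha> + of_int m < v - real k * \<rho>"
proof (cases "\<alpha> + of_int m < v - real k * \<rho>")
  case True
  then show ?thesis
    using below_orbit[OF True] matched_shift(2)[OF matched, of m "\<alpha> + of_int m"] by simp
next
  case False
  then obtain y where y: "v - real k * \<rho> < y" "y < \<alpha> + of_int m"
    using assms dense[of "v - real k * \<rho>" "\<alpha> + of_int m"] by auto
  then have "Z k < a + of_int m"
    using above_orbit[OF y(1)] matched_shift(2)[OF matched, of m y] by simp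
  then show ?thesis using False by simp
qed

text \<open>Off the jumps the cut decides the code of \<open>Z k\<close>. At a jump two codes are
  possible: that of \<open>v - k * \<rho>\<close> itself, recorded here, and that of the points just
  left of it, recorded by \<open>left_side\<close>.\<close>

definition right_side :: "nat \<Rightarrow> bool" where
  "right_side k \<longleftrightarrow> (\<forall>m. v - real k * \<rho> = of_int m \<longrightarrow> of_int m \<le> Z k) \<and>
     (\<forall>m. v - real k * \<rho> = \<alpha> + of_int m \<longrightarrow> a + of_int m \<le> Z k)"

definition left_side :: "nat \<Rightarrow> bool" where
  "left_side k \<longleftrightarrow> (\<forall>m. v - real k * \<rho> = of_int m \<longrightarrow> Z k < of_int m) \<and>
     (\<forall>m. v - real k * \<rho> = \<alpha> + of_int m \<longrightarrow> Z k < a + of_int m)"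

definition jump_time :: "nat \<Rightarrow> bool" where
  "jump_time k \<longleftrightarrow> (\<exists>m. v - real k * \<rho> = of_int m) \<or> (\<exists>m. v - real k * \<rho> = \<alpha> + of_int m)"

lemma not_jump_time: "\<not> jump_time k \<Longrightarrow> right_side k" "\<not> jump_time k \<Longrightarrow> left_side k"
  by (auto simp: jump_time_def right_side_def left_side_def)

lemma right_side_psi: "right_side k \<Longrightarrow> psi lam d a (Z k) = \<psi> (v - real k * \<rho>)"
  proof (rule psi_eqI)
    assume r: "right_side k"
    show "of_int m \<le> Z k \<longleftrightarrow> of_int m \<le> v - real k * \<rho>" for m
      using r int_le_orbit_iff[of k m] by (cases "v - real k * \<rho> = of_int m") (auto simp: right_side_def)
    show "a + of_int m \<le> Z k \<longleftrightarrow> \<alpha> + of_int m \<le> v - real k * \<rho>" for m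
      using r threshold_le_orbit_iff[of k m]
      by (cases "v - real k * \<rho> = \<alpha> + of_int m") (auto simp: right_side_def)
  qed

lemma left_side_psi:
  assumes "left_side k"
    and "\<And>m. of_int m \<le> u \<longleftrightarrow> of_int m < v - real k * \<rho>"
    and "\<And>m. \<alpha> + of_int m \<le> u \<longleftrightarrow> \<alpha> + of_int m < v - real k * \<rho>"
  shows "psi lam d a (Z k) = \<psi> u"
proof (rule psi_eqI)
  show "of_int m \<le> Z k \<longleftrightarrow> of_int m \<le> u" for m
    using assms(1) int_le_orbit_iff[of k m] unfolding assms(2)
    by (cases "v - real k * \<rho> = of_int m") (auto simp: left_side_def not_le)
  show "a + of_int m \<le> Z k \<longleftrightarrow> \<alpha> + of_int m \<le> u" for m
    using assms(1) threshold_le_orbit_iff[of k m] unfolding assms(3)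
    by (cases "v - real k * \<rho> = \<alpha> + of_int m") (auto simp: left_side_def not_le)
qed

text \<open>Equal codes select the same affine branch of slope \<open>lam\<close>. The reference
  point \<open>w\<close> is \<open>v\<close> for right sides and a point slightly below
  \<open>v\<close> for left sides.\<close>

lemma orbit_contract:
  assumes "\<And>j. i < j \<Longrightarrow> j \<le> i + n \<Longrightarrow> psi lam d a (Z j) = \<psi> (w - real j * \<rho>)"
  shows "Z i - \<phi> (w - real i * \<rho>) = lam ^ n * (Z (i + n) - \<phi> (w - real (i + n) * \<rho>))"
  using assms
proof (induction n)
  case (Suc n)
  define u where "u = w - real (i + Suc n) * \<rho>"
  have "w - real (i + n) * \<rho> = u + \<rho>"
    by (simp add: u_def algebra_simps)
  then have "\<phi> (w - real (i + n) * \<rho>) = lam * \<phi> u + \<delta> + \<psi> u"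
    by (simp add: phi_rec)
  moreover have "Z (i + n) = lam * Z (i + Suc n) + \<delta> + psi lam d a (Z (i + Suc n))"
    using orbit[of "i + n"] by (simp add: lift_psi)
  moreover have "psi lam d a (Z (i + Suc n)) = \<psi> u"
    using Suc.prems[of "i + Suc n"] by (simp add: u_def)
  ultimately have "Z (i + n) - \<phi> (w - real (i + n) * \<rho>) = lam * (Z (i + Suc n) - \<phi> u)"
    by (simp add: right_diff_distrib)
  moreover have "Z i - \<phi> (w - real i * \<rho>) = lam ^ n * (Z (i + n) - \<phi> (w - real (i + n) * \<rho>))"
    using Suc.prems by (intro Suc.IH) auto
  ultimately show ?case by (simp add: u_def)
qed simp

lemma orbit_eq_phi:
  assumes "\<And>j. i < j \<Longrightarrow> psi lam d a (Z j) = \<psi> (w - real j * \<rho>)"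
    and "\<And>j. \<bar>Z j - \<phi> (w - real j * \<rho>)\<bar> \<le> C"
  shows "Z i = \<phi> (w - real i * \<rho>)"
proof -
  have "\<bar>Z i - \<phi> (w - real i * \<rho>)\<bar> \<le> lam ^ n * C" for n
  proof -
    have "\<bar>lam ^ n * (Z (i + n) - \<phi> (w - real (i + n) * \<rho>))\<bar> \<le> lam ^ n * C"
      unfolding abs_mult using assms(2)[of "i + n"] lam by (intro mult_mono) auto
    then show ?thesis
      using orbit_contract[of i n w] assms(1) by simp
  qed
  moreover have "(\<lambda>n. lam ^ n * C) \<longlonglongrightarrow> 0"
    using lam by (intro tendsto_mult_left_zero LIMSEQ_power_zero) simp
  ultimately have "\<bar>Z i - \<phi> (w - real i * \<rho>)\<bar> \<le> 0"
    by (intro LIMSEQ_le_const) auto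
  then show ?thesis by simp
qed

lemma right_side_orbit_eq:
  assumes "\<And>j. i < j \<Longrightarrow> right_side j"
  shows "Z i = \<phi> (v - real i * \<rho>)"
  using orbit_eq_phi[OF _ orbit_near] right_side_psi assms by blast

text \<open>The inequality passes to all \<open>Z k\<close> and puts them on the right side of every
  jump, so contraction applies from the start.\<close>

lemma cut_attained:
  assumes "\<phi> v \<le> Z 0"
  shows "Z 0 = \<phi> v"
proof -
  have le: "\<phi> (v - real k * \<rho>) \<le> Z k" for k
    using assms phi_le_orbit_iff[of "v - real k * \<rho>" k] by simp
  have "right_side k" for k
    unfolding right_side_def
  proof (intro conjI allI impI)
    fix m assume "v - real k * \<rho> = of_int m"
    then show "of_int m \<le> Z k"
      using le[of k] matched_shift(1)[OF matched, of m "of_int m"] by simp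
  next
    fix m assume "v - real k * \<rho> = \<alpha> + of_int m"
    then show "a + of_int m \<le> Z k"
      using le[of k] matched_shift(2)[OF matched, of m "\<alpha> + of_int m"] by simp
  qed
  then show ?thesis
    using right_side_orbit_eq[of 0] by simp
qed

text \<open>If \<open>\<phi> v\<close> exceeded \<open>Z 0\<close>, then
  \<open>Z k < \<phi> (v - k * \<rho>)\<close> for every \<open>k\<close>. Each of the two jump
  classes is hit at most once, so after the last hit contraction gives equality instead.\<close>

lemma cut_irrational:
  assumes "\<rho> \<notin> \<rat>"
  shows "Z 0 = \<phi> v"
proof (rule ccontr)
  assume "Z 0 \<noteq> \<phi> v"
  then have less: "Z k < \<phi> (v - real k * \<rho>)" for k
    using cut_attained phi_le_orbit_iff[of "v - real k * \<rho>" k] by (auto simp: not_le)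
  have uniq: "k = l" if "v - real k * \<rho> = c + of_int m" "v - real l * \<rho> = c + of_int n" for k l m n c
  proof (rule ccontr)
    assume "k \<noteq> l"
    moreover have "(real l - real k) * \<rho> = of_int (m - n)"
      using that by (simp add: algebra_simps)
    ultimately have "\<rho> = of_int (m - n) / of_int (int l - int k)"
      by (simp add: field_simps)
    then show False using assms by (metis Rats_divide Rats_of_int)
  qed
  have "finite {k. \<exists>m. v - real k * \<rho> = c + of_int m}" (is "finite ?A") for c
  proof (cases "?A = {}")
    case False
    then obtain k where "k \<in> ?A" by blast
    then have "?A \<subseteq> {k}" using uniq by blast
    then show ?thesis using finite_subset by blast
  qed simp
  from this[of 0] this[of \<alpha>] have "finite {k. jump_time k}"
    by (simp add: jump_time_def Collect_disj_eq)
  then obtain N where N: "\<And>k. jump_time k \<Longrightarrow> k \<le> N"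
    by (metis finite_nat_set_iff_bounded_le mem_Collect_eq)
  have "Z N = \<phi> (v - real N * \<rho>)"
    using N not_jump_time(1) by (intro right_side_orbit_eq) (meson not_le)
  then show False using less[of N] by simp
qed

text \<open>If the cut is not attained, jump times form one residue class modulo \<open>q\<close>. Contraction over one
  period moves the orbit towards the end of the gap on its own side of the jump, so that it stays on
  that side; on the left, the comparison point is any \<open>v\<^sub>0 < v\<close> so close to \<open>v\<close> that \<open>\<phi>\<close> is constant on
  \<open>[v\<^sub>0, v)\<close>.\<close>

lemma cut_rational:
  assumes pq: "0 < p" "0 < q" "coprime p q" "\<rho> = real p / real q"
    and gen: "\<And>j. \<alpha> \<noteq> of_int j / real q"
  shows "\<exists>y. Z 0 = \<phi> y"
proof (rule ccontr)
  assume no: "\<nexists>y. Z 0 = \<phi> y"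
  have less: "Z k < \<phi> (v - real k * \<rho>)" for k
    using no cut_attained phi_le_orbit_iff[of "v - real k * \<rho>" k] by (auto simp: not_le)
  have "\<rho> \<in> \<rat>" using pq by simp
  then obtain v\<^sub>0 where v0: "v\<^sub>0 < v"
    "\<And>k m. of_int m + real k * \<rho> \<le> v\<^sub>0 \<longleftrightarrow> of_int m + real k * \<rho> < v"
    "\<And>k m. \<alpha> + of_int m + real k * \<rho> \<le> v\<^sub>0 \<longleftrightarrow> \<alpha> + of_int m + real k * \<rho> < v"
    using rational_left_window[of v] by metis
  have left_psi: "psi lam d a (Z k) = \<psi> (v\<^sub>0 - real k * \<rho>)" if "left_side k" for k
    using that v0(2,3)[of _ k] by (intro left_side_psi) (simp_all add: le_diff_eq less_diff_eq)
  have near: "\<bar>Z k - \<phi> (v\<^sub>0 - real k * \<rho>)\<bar> \<le> 1 + of_int \<lceil>v - v\<^sub>0\<rceil>" for k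
  proof -
    have "\<phi> (v\<^sub>0 - real k * \<rho>) \<le> \<phi> (v - real k * \<rho>)"
      using v0(1) by (intro phi_mono) simp
    moreover have "v - real k * \<rho> + of_int (- \<lceil>v - v\<^sub>0\<rceil>) \<le> v\<^sub>0 - real k * \<rho>"
      using le_of_int_ceiling[of "v - v\<^sub>0"] unfolding of_int_minus by linarith
    then have "\<phi> (v - real k * \<rho>) - of_int \<lceil>v - v\<^sub>0\<rceil> \<le> \<phi> (v\<^sub>0 - real k * \<rho>)"
      using phi_mono[of "v - real k * \<rho> + of_int (- \<lceil>v - v\<^sub>0\<rceil>)" "v\<^sub>0 - real k * \<rho>"]
        phi_shift[of "v - real k * \<rho>" "- \<lceil>v - v\<^sub>0\<rceil>"]
      by simp
    ultimately show ?thesis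
      using orbit_near[of k] by linarith
  qed
  have shift_q: "v - real (k + q) * \<rho> = v - real k * \<rho> - real p" for v k
    using pq by (simp add: field_simps)
  have int_q: "v - real (k + q) * \<rho> = of_int (m - int p)" if "v - real k * \<rho> = of_int m" for k m
    using that unfolding shift_q by simp
  have threshold_q: "v - real (k + q) * \<rho> = \<alpha> + of_int (m - int p)" if "v - real k * \<rho> = \<alpha> + of_int m" for k m
    using that unfolding shift_q by simp
  have phi_q: "\<phi> (w - real (k + q) * \<rho>) = \<phi> (w - real k * \<rho>) - real p" for w k
    using phi_shift[of "w - real k * \<rho>" "- int p"] unfolding shift_q by simp
  have dvd: "q dvd k - l" if "l \<le> k" "v - real k * \<rho> = c + of_int m" "v - real l * \<rho> = c + of_int n" for k l m n c
  proof -
    have "real (k - l) * \<rho> = of_int (n - m)"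
      using that by (simp add: algebra_simps of_nat_diff)
    then have "real (k - l) * real p = of_int (n - m) * real q"
      using pq by (simp add: field_simps)
    then have "of_int (int ((k - l) * p)) = (of_int ((n - m) * int q) :: real)"
      by simp
    then have "int ((k - l) * p) = (n - m) * int q"
      by (simp only: of_int_eq_iff)
    then have "int q dvd int ((k - l) * p)" by simp
    then have "q dvd (k - l) * p" by (simp only: int_dvd_int_iff)
    then show ?thesis
      using pq(3) by (simp add: coprime_commute coprime_dvd_mult_left_iff)
  qed
  \<comment> \<open>This is where genericity enters: hitting both classes would make
    \<open>\<alpha>\<close> a multiple of \<open>1 / q\<close>.\<close>
  have mixed: False if "v - real k * \<rho> = of_int m" "v - real l * \<rho> = \<alpha> + of_int n" for k l m n
  proof -
    have "\<alpha> = of_int (m - n) + (real k - real l) * \<rho>"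
      using that by (simp add: algebra_simps)
    also have "\<dots> = of_int ((m - n) * int q + (int k - int l) * int p) / real q"
      using pq by (simp add: add_divide_distrib diff_divide_distrib left_diff_distrib)
    finally show False using gen by blast
  qed
  have jump_dvd: "q dvd k - l" if jump: "jump_time k" "jump_time l" and le: "l \<le> k" for k l
  proof -
    consider m n where "v - real k * \<rho> = of_int m" "v - real l * \<rho> = of_int n"
      | m n where "v - real k * \<rho> = \<alpha> + of_int m" "v - real l * \<rho> = \<alpha> + of_int n"
      using jump mixed unfolding jump_time_def by blast
    then show ?thesis
      using dvd[OF le, of 0] dvd[OF le, of \<alpha>] by cases auto
  qed
  have sides: "right_side k \<or> left_side k" for k
  proof (cases "\<exists>m. v - real k * \<rho> = of_int m")
    case True
    then obtain m where m: "v - real k * \<rho> = of_int m" ..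
    then have "v - real k * \<rho> \<noteq> \<alpha> + of_int n" for n
      using mixed[of k m k n] by blast
    then show ?thesis
      using m unfolding right_side_def left_side_def by (simp add: le_less_linear)
  next
    case False
    then show ?thesis
      unfolding right_side_def left_side_def by (auto simp: not_le)
  qed
  have no_jump: "\<not> jump_time j" if "jump_time k" "k < j" "j < k + q" for j k
    using jump_dvd[of j k] that dvd_imp_le[of q "j - k"] by auto
  have right_step: "right_side k" if k: "jump_time k" and r: "right_side (k + q)" for k
  proof -
    have "right_side j" if "k < j" "j \<le> k + q" for j
      using r no_jump[OF k that(1)] not_jump_time(1) that(2) by (cases "j = k + q") auto
    then have "Z k - \<phi> (v - real k * \<rho>) = lam ^ q * (Z (k + q) - \<phi> (v - real (k + q) * \<rho>))"
      by (intro orbit_contract right_side_psi)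
    \<comment> \<open>The difference is negative by \<open>less\<close>, so shrinking it moves the
      orbit up, away from the left side.\<close>
    moreover have "1 * (Z (k + q) - \<phi> (v - real (k + q) * \<rho>)) \<le> lam ^ q * (Z (k + q) - \<phi> (v - real (k + q) * \<rho>))"
      using less[of "k + q"] lam by (intro mult_right_mono_neg power_le_one) auto
    ultimately have "Z (k + q) - \<phi> (v - real (k + q) * \<rho>) \<le> Z k - \<phi> (v - real k * \<rho>)"
      by (simp only: mult_1)
    then have "Z (k + q) + real p \<le> Z k"
      unfolding phi_q by simp
    moreover have "of_int (m - int p) \<le> Z (k + q)" if "v - real k * \<rho> = of_int m" for m
      using r int_q[OF that] unfolding right_side_def by blast
    moreover have "a + of_int (m - int p) \<le> Z (k + q)" if "v - real k * \<rho> = \<alpha> + of_int m" for m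
      using r threshold_q[OF that] unfolding right_side_def by blast
    ultimately show ?thesis
      unfolding right_side_def of_int_diff of_int_of_nat_eq by (smt (verit))
  qed
  have left_step: "left_side k" if k: "jump_time k" and r: "left_side (k + q)" for k
  proof -
    have "left_side j" if "k < j" "j \<le> k + q" for j
      using r no_jump[OF k that(1)] not_jump_time(2) that(2) by (cases "j = k + q") auto
    then have "Z k - \<phi> (v\<^sub>0 - real k * \<rho>) = lam ^ q * (Z (k + q) - \<phi> (v\<^sub>0 - real (k + q) * \<rho>))"
      by (intro orbit_contract left_psi)
    moreover have "lam ^ q * (Z (k + q) - \<phi> (v\<^sub>0 - real (k + q) * \<rho>)) \<le> 1 * (Z (k + q) - \<phi> (v\<^sub>0 - real (k + q) * \<rho>))"
      using below_orbit[of "v\<^sub>0 - real (k + q) * \<rho>" "k + q"] v0(1) lam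
      by (intro mult_right_mono power_le_one) auto
    ultimately have "Z k - \<phi> (v\<^sub>0 - real k * \<rho>) \<le> Z (k + q) - \<phi> (v\<^sub>0 - real (k + q) * \<rho>)"
      by (simp only: mult_1)
    then have "Z k \<le> Z (k + q) + real p"
      unfolding phi_q by simp
    moreover have "Z (k + q) < of_int (m - int p)" if "v - real k * \<rho> = of_int m" for m
      using r int_q[OF that] unfolding left_side_def by blast
    moreover have "Z (k + q) < a + of_int (m - int p)" if "v - real k * \<rho> = \<alpha> + of_int m" for m
      using r threshold_q[OF that] unfolding left_side_def by blast
    ultimately show ?thesis
      unfolding left_side_def of_int_diff of_int_of_nat_eq by (smt (verit))
  qed
  have jump_shift: "jump_time (k + i * q)" if "jump_time k" for k i
  proof -
    have eq: "v - real (k + i * q) * \<rho> = v - real k * \<rho> + of_int (- (int i * int p))"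
      using pq by (simp add: field_simps)
    show ?thesis
      using that unfolding jump_time_def eq
    proof (elim disjE exE)
      fix m assume "v - real k * \<rho> = of_int m"
      then show "(\<exists>m. v - real k * \<rho> + of_int (- (int i * int p)) = of_int m) \<or>
          (\<exists>m. v - real k * \<rho> + of_int (- (int i * int p)) = \<alpha> + of_int m)"
        by (intro disjI1 exI[of _ "m - int i * int p"]) simp
    next
      fix m assume "v - real k * \<rho> = \<alpha> + of_int m"
      then show "(\<exists>m. v - real k * \<rho> + of_int (- (int i * int p)) = of_int m) \<or>
          (\<exists>m. v - real k * \<rho> + of_int (- (int i * int p)) = \<alpha> + of_int m)"
        by (intro disjI2 exI[of _ "m - int i * int p"]) simp
    qed
  qed
  have right_all: "right_side (k + i * q) \<Longrightarrow> right_side k" if "jump_time k" for k i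
  proof (induction i)
    case (Suc i)
    then show ?case
      using right_step[OF jump_shift[OF that, of i]] by (simp add: algebra_simps)
  qed simp
  have left_all: "left_side (k + i * q) \<Longrightarrow> left_side k" if "jump_time k" for k i
  proof (induction i)
    case (Suc i)
    then show ?case
      using left_step[OF jump_shift[OF that, of i]] by (simp add: algebra_simps)
  qed simp
  \<comment> \<open>If all sides agreed, \<open>Z 0\<close> would be a value of
    \<open>\<phi>\<close>. So both sides occur at jump times, and the side of the later one
    propagates back to the earlier one.\<close>
  have "\<not> (\<forall>j>0. right_side j)"
    using right_side_orbit_eq[of 0] no by auto
  then obtain k where k: "jump_time k" "\<not> right_side k" "left_side k"
    using sides not_jump_time(1) by blast
  have "\<not> (\<forall>j>0. left_side j)"
    using orbit_eq_phi[of 0 v\<^sub>0, OF _ near] left_psi no by auto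
  then obtain l where l: "jump_time l" "\<not> left_side l" "right_side l"
    using sides not_jump_time(2) by blast
  show False
  proof (cases "k \<le> l")
    case True
    then obtain i where "l = k + i * q"
      using jump_dvd[OF l(1) k(1)] by (metis dvdE le_add_diff_inverse mult.commute)
    then show False using right_all[OF k(1)] k(2) l(3) by blast
  next
    case False
    then obtain i where "k = l + i * q"
      using jump_dvd[OF k(1) l(1)] by (metis dvdE le_add_diff_inverse mult.commute nat_le_linear)
    then show False using left_all[OF l(1)] l(2) k(3) by blast
  qed
qed

end

section \<open>The image of \<open>\<phi>\<close>, the attractor and its closure\<close>

context coded_map
begin

text \<open>The analysis of cuts is left as a hypothesis, so that the argument serves both
  irrational and generic rational rotations.\<close>

lemma attractor_subset_image:
  assumes matched
    and cut: "\<And>Z v. backward_orbit lam d \<delta> \<rho> \<alpha> a Z v \<Longrightarrow> \<exists>y. Z 0 = \<phi> y"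
  shows "attractor lam d \<delta> a \<subseteq> \<phi> ` {0..<1}"
proof
  fix x assume x: "x \<in> attractor lam d \<delta> a"
  then have unit: "0 \<le> x" "x < 1"
    unfolding attractor_def using INT_D[of x "\<lambda>n. (f ^^ n) ` {0..<1}" UNIV 0] by simp_all
  obtain Z where Z: "Z 0 = x" "\<And>k. F (Z (Suc k)) = Z k"
    using attractor_backward_orbit[OF x] by blast
  obtain v where "\<And>y. y < v \<Longrightarrow> \<phi> y \<le> x" "\<And>y. v < y \<Longrightarrow> x < \<phi> y"
    using phi_cut[of x] by blast
  then have "backward_orbit lam d \<delta> \<rho> \<alpha> a Z v"
    using Z assms(1) by unfold_locales auto
  then obtain y where y: "x = \<phi> y"
    using cut Z(1) by blast
  then have "0 \<le> y" "y < 1"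
    using unit assms(1) matched_shift(1)[OF assms(1), of 1 y] by (auto simp: matched_def)
  then show "x \<in> \<phi> ` {0..<1}"
    using y by simp
qed

lemma image_eq_attractor_irrational:
  assumes matched "\<rho> \<notin> \<rat>"
  shows "\<phi> ` {0..<1} = attractor lam d \<delta> a"
proof
  show "attractor lam d \<delta> a \<subseteq> \<phi> ` {0..<1}"
    using backward_orbit.cut_irrational assms(2) by (intro attractor_subset_image[OF assms(1)]) blast
qed (rule image_subset_attractor[OF assms(1)])

text \<open>Between two image points \<open>\<phi>\<close> has a jump, and below the upper end of
  that jump the image omits an interval of length \<open>g\<close>.\<close>

lemma closure_image_no_interval:
  assumes irr: "\<rho> \<notin> \<rat>" and "u < w"
  shows "\<not> {u..w} \<subseteq> closure (\<phi> ` {0..<1})"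
proof
  let ?S = "\<phi> ` {0..<1}"
  assume sub: "{u..w} \<subseteq> closure ?S"
  have meet: "\<exists>y\<in>{0..<1}. s < \<phi> y \<and> \<phi> y < t" if "u \<le> s" "s < t" "t \<le> w" for s t
  proof -
    have "(s + t) / 2 \<in> {s<..<t} \<inter> closure ?S"
      using that sub by auto
    then have "{s<..<t} \<inter> ?S \<noteq> {}"
      using open_Int_closure_eq_empty[OF open_greaterThanLessThan, of s t ?S] by blast
    then show ?thesis by auto
  qed
  obtain y\<^sub>1 where y1: "y\<^sub>1 \<in> {0..<1}" "u < \<phi> y\<^sub>1" "\<phi> y\<^sub>1 < (u + w) / 2"
    using meet[of u "(u + w) / 2"] assms(2) by auto
  obtain y\<^sub>2 where y2: "y\<^sub>2 \<in> {0..<1}" "(u + w) / 2 < \<phi> y\<^sub>2" "\<phi> y\<^sub>2 < w"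
    using meet[of "(u + w) / 2" w] assms(2) by auto
  have "y\<^sub>1 < y\<^sub>2"
    using y1 y2 phi_mono[of y\<^sub>2 y\<^sub>1] by linarith
  then obtain k m where km: "y\<^sub>1 < of_int m + real (Suc k) * \<rho>" "of_int m + real (Suc k) * \<rho> < y\<^sub>2"
    using irrational_jump_between[OF irr] by blast
  define y where "y = of_int m + real (Suc k) * \<rho>"
  define g where "g = lam ^ k * (1 - lam - d)"
  have g: "0 < g" using gap_pos(1) by (simp add: g_def)
  have gap: "\<phi> x + g \<le> \<phi> y" if "x < y" for x
    unfolding g_def using phi_gap_int[OF that, of m k] by (simp add: y_def)
  have y_less: "\<phi> y \<le> \<phi> y\<^sub>2"
    using km by (intro phi_mono) (simp add: y_def)
  obtain x where x: "\<phi> y - g < \<phi> x" "\<phi> x < \<phi> y"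
    using meet[of "\<phi> y - g" "\<phi> y"] g gap[of y\<^sub>1] km(1) y1(2) y2(3) y_less by (force simp: y_def)
  then show False
    using gap[of x] phi_mono[of y x] by (cases "x < y") auto
qed

text \<open>Right continuity brings image points near, and strict growth keeps them
  distinct.\<close>

lemma image_point_islimpt:
  assumes irr: "\<rho> \<notin> \<rat>" and y: "0 \<le> y" "y < 1"
  shows "\<phi> y islimpt \<phi> ` {0..<1}"
  unfolding islimpt_approachable
proof (intro allI impI)
  fix e :: real assume "0 < e"
  then have "\<forall>\<^sub>F t in at_right y. dist (\<phi> t) (\<phi> y) < e"
    using phi_tendsto_right tendstoD by blast
  moreover have "\<forall>\<^sub>F t in at_right y. t \<in> {y<..<1}"
    using y by (intro eventually_at_right_real)
  ultimately have "\<forall>\<^sub>F t in at_right y. dist (\<phi> t) (\<phi> y) < e \<and> t \<in> {y<..<1}"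
    by (rule eventually_conj)
  then obtain t where t: "dist (\<phi> t) (\<phi> y) < e" "y < t" "t < 1"
    using eventually_happens'[of "at_right y"] by auto
  then show "\<exists>x'\<in>\<phi> ` {0..<1}. x' \<noteq> \<phi> y \<and> dist x' (\<phi> y) < e"
    using y phi_strict_irrational[OF irr t(2)] by (intro bexI[of _ "\<phi> t"]) auto
qed

lemma cantor_set_closure_image:
  assumes m: matched and irr: "\<rho> \<notin> \<rat>"
  shows "cantor_set (closure (\<phi> ` {0..<1}))"
  unfolding cantor_set_def
proof (intro conjI ballI)
  let ?S = "\<phi> ` {0..<1}"
  show "closure ?S \<noteq> {}" by simp
  have "\<phi> y \<in> {0..1}" if "y \<in> {0..<1}" for y
    using matched_unit[OF m, of y] that by simp
  then have "?S \<subseteq> {0..1}"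
    by (rule image_subsetI)
  then have "bounded ?S"
    by (rule bounded_subset[OF bounded_closed_interval])
  then show "compact (closure ?S)" by simp
next
  let ?S = "\<phi> ` {0..<1}"
  fix x assume "x \<in> closure ?S"
  then consider "x \<in> ?S" | "x islimpt ?S"
    unfolding closure_def by blast
  then have "x islimpt ?S"
  proof cases
    case 1
    then obtain y where "y \<in> {0..<1}" "x = \<phi> y" ..
    then show ?thesis
      using image_point_islimpt[OF irr, of y] by simp
  qed
  from islimpt_subset[OF this closure_subset] show "\<not> x isolated_in closure ?S"
    by (simp add: isolated_in_islimpt_iff)
next
  let ?S = "\<phi> ` {0..<1}"
  fix x assume x: "x \<in> closure ?S"
  have "z = x" if z: "connected_component (closure ?S) x z" for z
  proof (rule ccontr)
    assume "z \<noteq> x"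
    obtain T where T: "connected T" "T \<subseteq> closure ?S" "x \<in> T" "z \<in> T"
      using z unfolding connected_component_def by blast
    \<comment> \<open>A connected set of reals containing two points contains the interval between
      them.\<close>
    have "{x..z} \<subseteq> closure ?S" "{z..x} \<subseteq> closure ?S"
      using connected_contains_Icc[OF T(1)] T(2-4) by blast+
    then show False
      using closure_image_no_interval[OF irr, of x z] closure_image_no_interval[OF irr, of z x] \<open>z \<noteq> x\<close>
      by (cases x z rule: linorder_cases) simp_all
  qed
  moreover have "connected_component (closure ?S) x x"
    using x by simp
  ultimately show "connected_component_set (closure ?S) x = {x}"
    by blast
qed

text \<open>Going round the cycle \<open>n\<close> times ends with \<open>n\<close> steps of
  \<open>f\<close>, so \<open>x\<close> is an \<open>n\<close>-th image of a point of its own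
  orbit.\<close>

lemma periodic_point_in_attractor:
  assumes "0 < q" "0 \<le> x" "x < 1" "(f ^^ q) x = x"
  shows "x \<in> attractor lam d \<delta> a"
proof -
  have unit: "0 \<le> (f ^^ n) x \<and> (f ^^ n) x < 1" for n
    by (cases n) (use assms f_map_unit in auto)
  have "x \<in> (f ^^ n) ` {0..<1}" for n
  proof
    have "(f ^^ (n * q)) x = x"
      using funpow_mod_eq[OF assms(4), of "n * q"] by simp
    moreover have "n * q = n + n * (q - 1)"
      using assms(1) by (simp add: diff_mult_distrib2)
    ultimately show "x = (f ^^ n) ((f ^^ (n * (q - 1))) x)"
      by (metis comp_apply funpow_add)
    show "(f ^^ (n * (q - 1))) x \<in> {0..<1}"
      using unit by simp
  qed
  then show ?thesis by (simp add: attractor_def)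
qed

end

subsection \<open>Rational rotations\<close>

locale rational_coding = coded_map +
  fixes p q :: nat
  assumes pq: "0 < p" "p < q" "coprime p q" "\<rho> = real p / real q" and matched: matched
begin

lemma q_pos: "0 < q"
  using pq by simp

text \<open>The class of \<open>c\<close> modulo \<open>1 / q\<close>, which is a single orbit of
  the rotation by \<open>p / q\<close>.\<close>

definition coset :: "real \<Rightarrow> real set" where
  "coset c = {y. 0 \<le> y \<and> y < 1 \<and> (\<exists>i. y = c + of_int i / real q)}"

text \<open>By Bezout every multiple of \<open>1 / q\<close> is a jump of \<open>\<phi>\<close>.
  Raising the multiplier by \<open>t * q\<close> makes it positive, and subtracting
  \<open>t * p\<close> from the integer part compensates.\<close>

lemma lattice_point:
  obtains k m where "of_int j / real q = of_int m + real (Suc k) * \<rho>"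
proof -
  obtain u w where "u * int p + w * int q = gcd (int p) (int q)"
    using bezout_int[of "int p" "int q"] by blast
  then have uw: "u * int p + w * int q = 1"
    using pq(3) by simp
  define t where "t = \<bar>j * u\<bar> + 1"
  define n where "n = j * u + t * int q"
  have "t * 1 \<le> t * int q"
    using q_pos by (intro mult_left_mono) (auto simp: t_def)
  moreover have "1 \<le> j * u + t"
    unfolding t_def by arith
  ultimately have "1 \<le> n"
    by (simp add: n_def)
  then have n: "real (Suc (nat (n - 1))) = of_int n"
    by simp
  have "j = (j * w - t * int p) * int q + n * int p"
    using arg_cong[OF uw, of "\<lambda>x. j * x"] by (simp add: n_def algebra_simps)
  then have "real_of_int j = of_int ((j * w - t * int p) * int q + n * int p)"
    by (rule arg_cong)
  then have "of_int j / real q = of_int (j * w - t * int p) + of_int n * \<rho>"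
    using q_pos pq(4) by (simp add: field_simps)
  then show thesis
    using that[of "j * w - t * int p" "nat (n - 1)"] n by simp
qed

lemma phi_less_lattice:
  assumes "x < of_int j / real q"
  shows "\<phi> x < \<phi> (of_int j / real q)"
proof -
  obtain k m where "of_int j / real q = of_int m + real (Suc k) * \<rho>"
    by (rule lattice_point)
  then show ?thesis
    using phi_gap_int[OF assms, of m k] gap_pos(1)[of k] by linarith
qed

lemma phi_less_lattice_threshold:
  assumes "\<alpha> < 1" "x < \<alpha> + of_int j / real q"
  shows "\<phi> x < \<phi> (\<alpha> + of_int j / real q)"
proof -
  obtain k m where "of_int j / real q = of_int m + real (Suc k) * \<rho>"
    by (rule lattice_point)
  then show ?thesis
    using phi_gap_threshold[OF assms, of m k] gap_pos(2)[of k] by simp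
qed

text \<open>A multiple of \<open>1 / q\<close> lies in \<open>(x, y]\<close>, and
  \<open>\<phi>\<close> jumps there.\<close>

lemma phi_less_spaced:
  assumes "x + 1 / real q \<le> y"
  shows "\<phi> x < \<phi> y"
proof -
  have fl: "of_int \<lfloor>real q * y\<rfloor> / real q \<le> y" "y < of_int \<lfloor>real q * y\<rfloor> / real q + 1 / real q"
    using q_pos by (simp_all add: field_simps) linarith+
  then have "\<phi> x < \<phi> (of_int \<lfloor>real q * y\<rfloor> / real q)"
    using assms by (intro phi_less_lattice) linarith
  also have "\<dots> \<le> \<phi> y"
    using fl by (intro phi_mono)
  finally show ?thesis .
qed

lemma rotation_period: "0 \<le> y \<Longrightarrow> y < 1 \<Longrightarrow> (R ^^ q) y = y"
  using q_pos pq(4) by (simp add: rotation_funpow frac_def floor_eq_iff)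

lemma rotation_orbit:
  assumes "0 \<le> y" "y < 1"
  shows "(\<lambda>k. (R ^^ k) y) ` {..<q} = coset y"
proof
  have "(R ^^ k) y \<in> coset y" for k
  proof -
    define i where "i = int k * int p - \<lfloor>y + real k * \<rho>\<rfloor> * int q"
    have "(R ^^ k) y = y + of_int i / real q"
      using q_pos pq(4) by (simp add: rotation_funpow[OF assms] frac_def i_def diff_divide_distrib)
    then show ?thesis
      using rotation_funpow_unit[OF assms, where n = k and \<rho> = \<rho>] unfolding coset_def by blast
  qed
  then show "(\<lambda>k. (R ^^ k) y) ` {..<q} \<subseteq> coset y" by blast
next
  show "coset y \<subseteq> (\<lambda>k. (R ^^ k) y) ` {..<q}"
  proof
    fix z assume "z \<in> coset y"
    then obtain i where z: "0 \<le> z" "z < 1" "z = y + of_int i / real q"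
      by (auto simp: coset_def)
    obtain k m where km: "of_int i / real q = of_int m + real (Suc k) * \<rho>"
      by (rule lattice_point)
    have "(R ^^ Suc k) y = z"
      using z km unfolding rotation_funpow[OF assms]
      by (intro frac_unique_iff[THEN iffD2]) auto
    then have "(R ^^ (Suc k mod q)) y = z"
      using funpow_mod_eq[OF rotation_period[OF assms], of "Suc k"] by simp
    then show "z \<in> (\<lambda>k. (R ^^ k) y) ` {..<q}"
      using q_pos by force
  qed
qed

lemma orbit_phi:
  assumes "0 \<le> y" "y < 1"
  shows "(\<lambda>k. (f ^^ k) (\<phi> y)) ` {..<q} = \<phi> ` coset y"
  using arg_cong[OF rotation_orbit[OF assms], of "(`) \<phi>"]
  by (simp add: image_image matched_orbit[OF matched])

lemma coset_shift:
  assumes "y \<in> coset c"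
  shows "coset y = coset c"
proof -
  obtain i where i: "y = c + of_int i / real q"
    using assms by (auto simp: coset_def)
  have "(\<exists>j. z = y + of_int j / real q) \<longleftrightarrow> (\<exists>j. z = c + of_int j / real q)" for z
  proof
    assume "\<exists>j. z = y + of_int j / real q"
    then obtain j where "z = y + of_int j / real q" ..
    then show "\<exists>j. z = c + of_int j / real q"
      by (intro exI[of _ "i + j"]) (simp add: i add_divide_distrib)
  next
    assume "\<exists>j. z = c + of_int j / real q"
    then obtain j where "z = c + of_int j / real q" ..
    then show "\<exists>j. z = y + of_int j / real q"
      by (intro exI[of _ "j - i"]) (simp add: i diff_divide_distrib)
  qed
  then show ?thesis by (simp add: coset_def)
qed

lemma coset_phi_distinct:
  assumes "y \<in> coset c" "z \<in> coset c" "y < z"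
  shows "\<phi> y < \<phi> z"
proof -
  obtain i j where ij: "y = c + of_int i / real q" "z = c + of_int j / real q"
    using assms by (auto simp: coset_def)
  then have "i < j"
    using assms(3) q_pos by (simp add: divide_less_cancel)
  then have "(of_int i + 1) / real q \<le> of_int j / real q"
    by (intro divide_right_mono) auto
  then show ?thesis
    by (intro phi_less_spaced) (simp add: ij add_divide_distrib)
qed

text \<open>Coprimality gives the rotation minimal period \<open>q\<close>, and
  \<open>\<phi>\<close> is injective on a coset, so the period does not drop.\<close>

lemma periodic_orbit_coset:
  assumes y: "0 \<le> y" "y < 1"
  shows "periodic_orbit f q (\<phi> ` coset y)"
  unfolding periodic_orbit_def
proof (intro conjI q_pos bexI)
  show "(f ^^ q) (\<phi> y) = \<phi> y"
    by (simp add: matched_orbit[OF matched] rotation_period[OF y])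
  show "\<forall>k. 0 < k \<and> k < q \<longrightarrow> (f ^^ k) (\<phi> y) \<noteq> \<phi> y"
  proof (intro allI impI)
    fix k assume k: "0 < k \<and> k < q"
    have in_coset: "(R ^^ k) y \<in> coset y" "(R ^^ 0) y \<in> coset y"
      using rotation_orbit[OF y] k q_pos by blast+
    have "(R ^^ k) y \<noteq> y"
    proof
      assume "(R ^^ k) y = y"
      then obtain n where "real k * \<rho> = of_int n"
        by (simp add: rotation_funpow[OF y] frac_def)
      then have "real k * real p = of_int n * real q"
        using q_pos pq(4) by (simp add: field_simps)
      then have "(of_int (int (k * p)) :: real) = of_int (n * int q)"
        by simp
      then have "int (k * p) = n * int q"
        by (simp only: of_int_eq_iff)
      then have "int q dvd int (k * p)" by simp
      then have "q dvd k * p" by (simp only: int_dvd_int_iff)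
      then have "q dvd k"
        using pq(3) by (simp add: coprime_commute coprime_dvd_mult_left_iff)
      then show False using k by (auto dest: dvd_imp_le)
    qed
    then show "(f ^^ k) (\<phi> y) \<noteq> \<phi> y"
      using in_coset coset_phi_distinct[of "(R ^^ k) y" y y] coset_phi_distinct[of y y "(R ^^ k) y"]
      by (simp add: matched_orbit[OF matched]) (metis less_irrefl linorder_neqE)
  qed
  show "\<phi> ` coset y = (\<lambda>k. (f ^^ k) (\<phi> y)) ` {..<q}"
    by (rule orbit_phi[OF y, symmetric])
  show "\<phi> y \<in> {0..<1}"
    using matched_unit[OF matched y] by simp
qed

lemma floor_lattice: "of_int \<lfloor>real q * y\<rfloor> / real q \<le> y"
  using q_pos by (simp add: field_simps)

lemma floor_between:
  assumes "of_int \<lfloor>real q * y\<rfloor> / real q \<le> x" "x \<le> y"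
  shows "\<lfloor>real q * x\<rfloor> = \<lfloor>real q * y\<rfloor>"
proof (rule antisym)
  show "\<lfloor>real q * x\<rfloor> \<le> \<lfloor>real q * y\<rfloor>"
    using assms(2) q_pos by (intro floor_mono) simp
  have "of_int \<lfloor>real q * y\<rfloor> \<le> real q * x"
    using assms(1) q_pos by (simp add: field_simps)
  then show "\<lfloor>real q * y\<rfloor> \<le> \<lfloor>real q * x\<rfloor>"
    by (simp add: le_floor_iff)
qed

text \<open>Moving \<open>y\<close> down to the nearest point of either lattice changes neither
  floor, hence not the value of \<open>\<phi>\<close>; the point stays nonnegative because 0 is on
  the first lattice.\<close>

lemma phi_representative:
  assumes y: "0 \<le> y" "y < 1"
  obtains x where "x \<in> coset 0 \<union> coset \<alpha>" "\<phi> y = \<phi> x"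
proof -
  let ?x\<^sub>0 = "of_int \<lfloor>real q * y\<rfloor> / real q"
  let ?x\<^sub>1 = "\<alpha> + of_int \<lfloor>real q * (y - \<alpha>)\<rfloor> / real q"
  define x where "x = max ?x\<^sub>0 ?x\<^sub>1"
  have x_le: "x \<le> y"
    using floor_lattice[of y] floor_lattice[of "y - \<alpha>"] by (simp add: x_def)
  have "0 \<le> ?x\<^sub>0" using y by simp
  then have "0 \<le> x" by (simp add: x_def)
  then have "x \<in> coset 0 \<union> coset \<alpha>"
    using x_le y by (auto simp: coset_def x_def max_def)
  moreover have "\<phi> y = \<phi> x"
  proof (rule phi_eq_rational[symmetric])
    show "0 < q" "\<rho> = of_int (int p) / real q" using q_pos pq(4) by simp_all
    show "\<lfloor>real q * x\<rfloor> = \<lfloor>real q * y\<rfloor>"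
      using x_le by (intro floor_between) (simp_all add: x_def)
    show "\<lfloor>real q * (x - \<alpha>)\<rfloor> = \<lfloor>real q * (y - \<alpha>)\<rfloor>"
      using x_le by (intro floor_between) (simp_all add: x_def max_def le_diff_eq add.commute)
  qed
  ultimately show thesis by (rule that)
qed

lemma image_eq_cosets: "\<phi> ` {0..<1} = \<phi> ` coset 0 \<union> \<phi> ` coset \<alpha>"
proof
  show "\<phi> ` {0..<1} \<subseteq> \<phi> ` coset 0 \<union> \<phi> ` coset \<alpha>"
  proof (rule image_subsetI)
    fix y :: real assume "y \<in> {0..<1}"
    then obtain x where "x \<in> coset 0 \<union> coset \<alpha>" "\<phi> y = \<phi> x"
      using phi_representative[of y] by auto
    then show "\<phi> y \<in> \<phi> ` coset 0 \<union> \<phi> ` coset \<alpha>"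
      by auto
  qed
  show "\<phi> ` coset 0 \<union> \<phi> ` coset \<alpha> \<subseteq> \<phi> ` {0..<1}"
    by (auto simp: coset_def)
qed

lemma lattice_threshold_iff:
  "\<alpha> \<in> (\<lambda>j. real j / real q) ` {0..q} \<longleftrightarrow> (\<exists>j. \<alpha> = of_int j / real q)"
proof
  assume "\<alpha> \<in> (\<lambda>j. real j / real q) ` {0..q}"
  then obtain j where "\<alpha> = real j / real q" by blast
  then show "\<exists>j. \<alpha> = of_int j / real q"
    by (intro exI[of _ "int j"]) simp
next
  assume "\<exists>j. \<alpha> = of_int j / real q"
  then obtain j where j: "\<alpha> = of_int j / real q" ..
  then have "0 \<le> j" "j \<le> int q"
    using alpha q_pos by (simp_all add: zero_le_divide_iff divide_le_eq)
  then show "\<alpha> \<in> (\<lambda>j. real j / real q) ` {0..q}"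
    using j by (intro image_eqI[of _ _ "nat j"]) auto
qed

lemma lattice_image_orbit:
  assumes "\<alpha> = of_int j / real q"
  shows "periodic_orbit f q (\<phi> ` {0..<1})"
proof -
  have "coset \<alpha> = coset 0"
  proof -
    have "(\<exists>i. y = \<alpha> + of_int i / real q) \<longleftrightarrow> (\<exists>i. y = 0 + of_int i / real q)" for y
    proof
      assume "\<exists>i. y = \<alpha> + of_int i / real q"
      then obtain i where "y = \<alpha> + of_int i / real q" ..
      then show "\<exists>i. y = 0 + of_int i / real q"
        using assms by (intro exI[of _ "j + i"]) (simp add: add_divide_distrib)
    next
      assume "\<exists>i. y = 0 + of_int i / real q"
      then obtain i where "y = 0 + of_int i / real q" ..
      then show "\<exists>i. y = \<alpha> + of_int i / real q"
        using assms by (intro exI[of _ "i - j"]) (simp add: diff_divide_distrib)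
    qed
    then show ?thesis by (simp add: coset_def)
  qed
  then show ?thesis
    using periodic_orbit_coset[of 0] by (simp add: image_eq_cosets)
qed

text \<open>Periodic points lie in the attractor, hence in the image of one of the two cosets, which
  leaves no third periodic orbit.\<close>

lemma generic_image:
  assumes gen: "\<And>j. \<alpha> \<noteq> of_int j / real q"
  shows "\<phi> ` {0..<1} = attractor lam d \<delta> a"
    and "{P. periodic_orbit f q P} = {\<phi> ` coset 0, \<phi> ` coset \<alpha>}"
    and "\<phi> ` coset 0 \<noteq> \<phi> ` coset \<alpha>"
proof -
  have "attractor lam d \<delta> a \<subseteq> \<phi> ` {0..<1}"
    using attractor_subset_image[OF matched] backward_orbit.cut_rational[OF _ pq(1) q_pos pq(3,4) gen]
    by blast
  then show eq: "\<phi> ` {0..<1} = attractor lam d \<delta> a"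
    using image_subset_attractor[OF matched] by blast
  have alpha': "0 < \<alpha>" "\<alpha> < 1"
    using gen[of 0] gen[of "int q"] alpha q_pos by auto
  show "{P. periodic_orbit f q P} = {\<phi> ` coset 0, \<phi> ` coset \<alpha>}"
  proof (intro antisym subsetI)
    fix P assume "P \<in> {P. periodic_orbit f q P}"
    then obtain x where x: "0 \<le> x" "x < 1" "(f ^^ q) x = x" "P = (\<lambda>k. (f ^^ k) x) ` {..<q}"
      by (auto simp: periodic_orbit_def)
    then have "x \<in> \<phi> ` coset 0 \<union> \<phi> ` coset \<alpha>"
      using periodic_point_in_attractor[OF q_pos x(1-3)] eq image_eq_cosets by simp
    then obtain y where y: "y \<in> coset 0 \<or> y \<in> coset \<alpha>" "x = \<phi> y"
      by blast
    then have "P = \<phi> ` coset y"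
      using x(4) orbit_phi[of y] by (auto simp: coset_def)
    then show "P \<in> {\<phi> ` coset 0, \<phi> ` coset \<alpha>}"
      using y(1) coset_shift by auto
  next
    fix P assume "P \<in> {\<phi> ` coset 0, \<phi> ` coset \<alpha>}"
    then show "P \<in> {P. periodic_orbit f q P}"
      using periodic_orbit_coset[of 0] periodic_orbit_coset[of \<alpha>] alpha' by auto
  qed
  \<comment> \<open>Points of \<open>coset \<alpha>\<close> are positive and are threshold jumps, so
    their values lie strictly above \<open>\<phi> 0\<close>.\<close>
  have "\<phi> 0 \<notin> \<phi> ` coset \<alpha>"
  proof
    assume "\<phi> 0 \<in> \<phi> ` coset \<alpha>"
    then obtain i where i: "0 \<le> \<alpha> + of_int i / real q" "\<phi> 0 = \<phi> (\<alpha> + of_int i / real q)"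
      by (auto simp: coset_def)
    have "\<alpha> + of_int i / real q \<noteq> 0"
      using gen[of "- i"] by auto
    then have "\<phi> 0 < \<phi> (\<alpha> + of_int i / real q)"
      using i(1) alpha' by (intro phi_less_lattice_threshold) auto
    then show False using i(2) by simp
  qed
  moreover have "0 \<in> coset 0"
    by (auto simp: coset_def intro: exI[of _ 0])
  ultimately show "\<phi> ` coset 0 \<noteq> \<phi> ` coset \<alpha>"
    by blast
qed

end

theorem theorem2p10:
  fixes lam d \<delta> a \<rho> \<alpha> :: real
  assumes "lam \<in> {0<..<1}" and "d \<in> {0<..<1 - lam}"
    and "\<delta> \<in> {1 - lam - d<..<1}" and "a \<in> {0..1}"
    and "\<rho> \<in> {0<..<1}" and "\<alpha> \<in> {0..1}"
  shows "(parameter_condition lam d \<delta> a \<rho> \<alpha> \<longleftrightarrow> semiconjugacy_condition lam d \<delta> a \<rho> \<alpha>) \<and>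
    (semiconjugacy_condition lam d \<delta> a \<rho> \<alpha> \<longleftrightarrow> coding_condition lam d \<delta> a \<rho> \<alpha>) \<and>
    (parameter_condition lam d \<delta> a \<rho> \<alpha> \<or> semiconjugacy_condition lam d \<delta> a \<rho> \<alpha> \<or>
       coding_condition lam d \<delta> a \<rho> \<alpha> \<longrightarrow>
     phi lam d \<delta> \<rho> \<alpha> ` {0..<1} \<subseteq> attractor lam d \<delta> a \<and>
     (\<forall>p q :: nat. 0 < p \<and> p < q \<and> coprime p q \<and> \<rho> = real p / real q \<longrightarrow>
        (if \<alpha> \<in> (\<lambda>j. real j / real q) ` {0..q}
         then periodic_orbit (f_map lam d \<delta> a) q (phi lam d \<delta> \<rho> \<alpha> ` {0..<1})
         else phi lam d \<delta> \<rho> \<alpha> ` {0..<1} = attractor lam d \<delta> a \<and>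
              card {P. periodic_orbit (f_map lam d \<delta> a) q P} = 2 \<and>
              phi lam d \<delta> \<rho> \<alpha> ` {0..<1} = \<Union>{P. periodic_orbit (f_map lam d \<delta> a) q P})) \<and>
     (\<rho> \<notin> \<rat> \<longrightarrow>
        phi lam d \<delta> \<rho> \<alpha> ` {0..<1} = attractor lam d \<delta> a \<and>
        cantor_set (closure (attractor lam d \<delta> a))))"
proof -
  interpret coded_map lam d \<delta> \<rho> \<alpha> a
    using assms by unfold_locales auto
  have rational: "if \<alpha> \<in> (\<lambda>j. real j / real q) ` {0..q}
      then periodic_orbit f q (\<phi> ` {0..<1})
      else \<phi> ` {0..<1} = attractor lam d \<delta> a \<and> card {P. periodic_orbit f q P} = 2 \<and>
        \<phi> ` {0..<1} = \<Union>{P. periodic_orbit f q P}"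
    if m: matched and pq: "0 < p \<and> p < q \<and> coprime p q \<and> \<rho> = real p / real q" for p q
  proof -
    interpret rational_coding lam d \<delta> \<rho> \<alpha> a p q
      using m pq by unfold_locales auto
    show ?thesis
    proof (cases "\<exists>j. \<alpha> = of_int j / real q")
      case True
      then show ?thesis
        using lattice_image_orbit by (auto simp: lattice_threshold_iff)
    next
      case False
      then have gen: "\<And>j. \<alpha> \<noteq> of_int j / real q" by blast
      have "card {P. periodic_orbit f q P} = 2"
        using generic_image(3)[OF gen] by (simp add: generic_image(2)[OF gen])
      moreover have "\<phi> ` {0..<1} = \<Union>{P. periodic_orbit f q P}"
        unfolding generic_image(2)[OF gen] image_eq_cosets by simp
      moreover have "\<alpha> \<notin> (\<lambda>j. real j / real q) ` {0..q}"
        using False lattice_threshold_iff by blast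
      ultimately show ?thesis
        using generic_image(1)[OF gen] by simp
    qed
  qed
  have irrational: "\<phi> ` {0..<1} = attractor lam d \<delta> a \<and> cantor_set (closure (attractor lam d \<delta> a))"
    if matched "\<rho> \<notin> \<rat>"
    using image_eq_attractor_irrational[OF that] cantor_set_closure_image[OF that] by simp
  show ?thesis
    unfolding parameter_condition_iff_matched semiconjugacy_condition_iff_matched
      coding_condition_iff_matched
    using image_subset_attractor rational irrational by blast
qed

end
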